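(* Let $S\subseteq\mathbb{R}^n$ be nonempty and closed, let $I=\{1,\dots,m\}$, let $\ell,\beta\ge 0$, and let $O\subseteq\mathbb{R}^n$ be an open set containing $S$. For each $i\in I$, suppose that, on $O$, $f_i\colon\mathbb{R}^n\to(-\infty,+\infty]$ is locally Lipschitz, $g_i\colon\mathbb{R}^n\to(-\infty,+\infty]$ is differentiable with $\ell$-Lipschitz continuous gradient, and $h_i\colon\mathbb{R}^n\to\mathbb{R}$ is $\beta$-weakly convex. Put $F_i:=f_i+g_i-h_i$ and consider the multiobjective problem $\min_{x\in S}(F_1(x),\dots,F_m(x))$. Let $\bar\gamma\in\left(0,\frac{1}{\ell+\beta}\right)$ (with $\frac{1}{\ell+\beta}=+\infty$ if $\ell+\beta=0$), and let $(x^k)_{k\in\mathbb{N}}$ be a sequence with $x^0\in S$ such that for every $k\in\mathbb{N}$ there are $u_i^k\in\partial h_i(x^k)$ ($i\in I$) and $\gamma_k\in(0,\bar\gamma]$ with $$x^{k+1}\in\operatorname*{argmin}_{x\in S}\left(\max_{i\in I}\left(f_i(x)-f_i(x^k)+\langle\nabla g_i(x^k)-u_i^k,x-x^k\rangle\right)+\frac{1}{2\gamma_k}\|x-x^k\|^2\right).$$ Then the following hold: (a) For all $i\in I$ and all $k\in\mathbb{N}$, $$F_i(x^{k+1})+\left(\frac{1}{2\gamma_k}-\frac{\ell+\beta}{2}\right)\|x^{k+1}-x^k\|^2\le F_i(x^k).$$ (b) If there exists $i\in I$ such that $F_i$ is bounded from below on $S$, then $\sum_{k=0}^{+\infty}\|x^{k+1}-x^k\|^2<+\infty$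 and consequently $x^{k+1}-x^k\to0$ as $k\to+\infty$. (c) If there exists $i\in I$ such that the set $\{x\in S:F_i(x)\le F_i(x^0)\}$ is bounded, then the sequence $(x^k)_{k\in\mathbb{N}}$ is bounded. (d) If $\liminf_{k\to+\infty}\gamma_k>0$ and there exists $i\in I$ such that $F_i$ is bounded from below on $S$, then every cluster point of $(x^k)_{k\in\mathbb{N}}$ is a stationary point of the problem.
   Context: $\mathbb{R}^n$ carries the usual inner product and Euclidean norm; $\mathbb{R}^m_+$ is the nonnegative orthant; sums and differences of sets are Minkowski. Normal cones: for a set $S$ and $x\in S$, the regular (Fréchet) normal cone is $\widehat N_S(x)=\{v:\limsup_{y\to x,\,y\in S,\,y\ne x}\langle v,y-x\rangle/\|y-x\|\le 0\}$, and the limiting (Mordukhovich) normal cone $N_S(x)$ is the set of $v$ for which there are $x_k\to x$ with $x_k\in S$ and $v_k\to v$ with $v_k\in\widehat N_S(x_k)$. Subdifferential: for $\varphi\colon\mathbb{R}^n\to(-\infty,+\infty]$ and $x$ with $\varphi(x)<+\infty$, the limiting (Mordukhovich) subdifferential is $\partial\varphi(x)=\{v:(v,-1)\in N_{\operatorname{epi}\varphi}(x,\varphi(x))\}$, where $\operatorname{epi}\varphi=\{(x,\alpha)\in\mathbb{R}^n\times\mathbb{R}:\alpha\ge\varphi(x)\}$. $\varphi$ is locally Lipschitz on an open set if every point of the set has a neighborhood on which $\varphi$ is finite and Lipschitz. $\varphi$ is $\beta$-weakly convex on a set $O$ if $\beta\ge0$ and $\varphi+\delta_O+\frac{\beta}{2}\|\cdot\|^2$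 is convex as a function $\mathbb{R}^n\to(-\infty,+\infty]$, where $\delta_O$ is $0$ on $O$ and $+\infty$ elsewhere (in particular, since each $h_i$ is real-valued, $O$ is then convex). $\bar x\in S$ is a stationary point if there exists $\lambda\in\mathbb{R}^m_+\setminus\{0\}$ with $0\in\sum_{i\in I}\lambda_i(\partial f_i(\bar x)+\nabla g_i(\bar x)-\partial h_i(\bar x))+N_S(\bar x)$. *)

theory Defs
  imports "HOL-Analysis.Analysis"
begin

text \<open>
  Functions into \<open>(-\<infinity>, +\<infinity>]\<close> are rendered as \<^typ>\<open>ereal\<close>-valued functions; that they avoid
  \<open>-\<infinity>\<close> is assumed where they are introduced.
\<close>

text \<open>
  The filter \<open>at x within S\<close> excludes \<open>x\<close> itself.  If \<open>x\<close> is isolated in \<open>S\<close>, the upper limit is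
  \<open>-\<infinity>\<close> and every vector is a regular normal.
\<close>

definition regular_normal_cone :: "'a::real_inner set \<Rightarrow> 'a \<Rightarrow> 'a set" where
  "regular_normal_cone S x =
     {v. x \<in> S \<and> Limsup (at x within S) (\<lambda>y. ereal (v \<bullet> (y - x) / norm (y - x))) \<le> 0}"

definition limiting_normal_cone :: "'a::real_inner set \<Rightarrow> 'a \<Rightarrow> 'a set" where
  "limiting_normal_cone S x =
     {v. x \<in> S \<and> (\<exists>xs vs. (\<forall>k::nat. xs k \<in> S \<and> vs k \<in> regular_normal_cone S (xs k)) \<and>
                         xs \<longlonglongrightarrow> x \<and> vs \<longlonglongrightarrow> v)}"

definition epi :: "('a \<Rightarrow> ereal) \<Rightarrow> ('a \<times> real) set" where
  "epi \<phi> = {(x, \<alpha>). \<phi> x \<le> ereal \<alpha>}"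

text \<open>The norm and inner product of the product type are the Euclidean ones.\<close>

definition limiting_subdifferential :: "('a::real_inner \<Rightarrow> ereal) \<Rightarrow> 'a \<Rightarrow> 'a set" where
  "limiting_subdifferential \<phi> x =
     {v. \<bar>\<phi> x\<bar> \<noteq> \<infinity> \<and> (v, -1) \<in> limiting_normal_cone (epi \<phi>) (x, real_of_ereal (\<phi> x))}"

definition locally_lipschitz_on :: "'a::metric_space set \<Rightarrow> ('a \<Rightarrow> ereal) \<Rightarrow> bool" where
  "locally_lipschitz_on U \<phi> \<longleftrightarrow>
     (\<forall>x\<in>U. \<exists>V L. open V \<and> x \<in> V \<and> (\<forall>y\<in>V. \<bar>\<phi> y\<bar> \<noteq> \<infinity>) \<and>
                  L-lipschitz_on V (\<lambda>y. real_of_ereal (\<phi> y)))"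

text \<open>Meaningful only where \<open>\<phi>\<close> is finite near \<open>x\<close> and differentiable at \<open>x\<close>.\<close>

definition gradient :: "('a::real_inner \<Rightarrow> ereal) \<Rightarrow> 'a \<Rightarrow> 'a" where
  "gradient \<phi> x = (THE v. GDERIV (\<lambda>y. real_of_ereal (\<phi> y)) x :> v)"

text \<open>To be used for open \<open>U\<close>, so that finiteness on \<open>U\<close> is finiteness near each point of \<open>U\<close>.\<close>

definition lipschitz_gradient_on :: "real \<Rightarrow> 'a::real_inner set \<Rightarrow> ('a \<Rightarrow> ereal) \<Rightarrow> bool" where
  "lipschitz_gradient_on l U \<phi> \<longleftrightarrow>
     (\<forall>x\<in>U. \<bar>\<phi> x\<bar> \<noteq> \<infinity> \<and> (\<lambda>y. real_of_ereal (\<phi> y)) differentiable (at x)) \<and>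
     l-lipschitz_on U (gradient \<phi>)"

definition convex_ereal :: "('a::real_vector \<Rightarrow> ereal) \<Rightarrow> bool" where
  "convex_ereal \<phi> \<longleftrightarrow>
     (\<forall>x y. \<forall>t::real. 0 < t \<and> t < 1 \<longrightarrow>
        \<phi> ((1 - t) *\<^sub>R x + t *\<^sub>R y) \<le> ereal (1 - t) * \<phi> x + ereal t * \<phi> y)"

definition indicator_infty :: "'a set \<Rightarrow> 'a \<Rightarrow> ereal" where
  "indicator_infty U x = (if x \<in> U then 0 else \<infinity>)"

definition weakly_convex_on :: "real \<Rightarrow> 'a::real_normed_vector set \<Rightarrow> ('a \<Rightarrow> ereal) \<Rightarrow> bool" where
  "weakly_convex_on \<beta> U \<phi> \<longleftrightarrow>
     0 \<le> \<beta> \<and> convex_ereal (\<lambda>x. \<phi> x + indicator_infty U x + ereal (\<beta> / 2 * (norm x)\<^sup>2))"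

text \<open>
  The objectives are indexed by a finite type \<open>'m\<close> with \<open>m = CARD('m) \<ge> 1\<close>.
\<close>

definition objective ::
  "('m \<Rightarrow> 'a \<Rightarrow> ereal) \<Rightarrow> ('m \<Rightarrow> 'a \<Rightarrow> ereal) \<Rightarrow> ('m \<Rightarrow> 'a \<Rightarrow> real) \<Rightarrow> 'm \<Rightarrow> 'a \<Rightarrow> ereal" where
  "objective f g h i x = f i x + g i x - ereal (h i x)"

text \<open>
  The sums of sets below are Minkowski sums.  The Minkowski difference is spelled out
  elementwise, since \<open>-\<close> on sets is the set-theoretic difference.
\<close>

definition stationary_point ::
  "(real^'n) set \<Rightarrow> ('m::finite \<Rightarrow> real^'n \<Rightarrow> ereal) \<Rightarrow> ('m \<Rightarrow> real^'n \<Rightarrow> ereal) \<Rightarrow>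
   ('m \<Rightarrow> real^'n \<Rightarrow> real) \<Rightarrow> real^'n \<Rightarrow> bool" where
  "stationary_point S f g h x \<longleftrightarrow>
     x \<in> S \<and>
     (\<exists>lam :: real^'m. (\<forall>i. 0 \<le> lam $ i) \<and> lam \<noteq> 0 \<and>
        0 \<in> (\<Sum>i\<in>UNIV. (\<lambda>w. lam $ i *\<^sub>R w) `
               {a + gradient (g i) x - c | a c.
                  a \<in> limiting_subdifferential (f i) x \<and>
                  c \<in> limiting_subdifferential (\<lambda>y. ereal (h i y)) x})
            + limiting_normal_cone S x)"

end

theory Submission
  imports Defs
begin

text \<open>
  The descent inequality combines three bounds on a step from \<open>x k\<close> to \<open>x (Suc k)\<close>: the subproblem has
  the value zero at \<open>x k\<close>, which bounds every branch of the maximum at \<open>x (Suc k)\<close>; the quadratic upper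
  bound for \<open>g i\<close> (\<open>descent_lemma\<close>); and the quadratic lower bound for \<open>h i\<close> along its limiting
  subgradients (\<open>weakly_convex_subgradient_inequality\<close>).  Since \<open>\<gamma> k \<le> \<gamma>bar\<close> and \<open>(l + \<beta>) * \<gamma>bar < 1\<close>, the
  coefficient of the squared step is bounded below by a positive constant.  Square summability follows by
  telescoping, and boundedness follows because the iterates stay in a sublevel set.

  For a cluster point \<open>a\<close>, the subgradients \<open>u k i\<close> are bounded near \<open>a\<close>, so that along a subsequence
  they converge to limiting subgradients \<open>c i\<close> of \<open>h i\<close> at \<open>a\<close>.  Successive iterates have the same
  limit, and passing to the limit in the subproblems (\<open>limit_of_model_minimizers\<close>) shows that \<open>a\<close>
  minimizes over \<open>S\<close> the maximum over \<open>i\<close> of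
  \<open>f i y - f i a + (gradient (g i) a - c i) \<bullet> (y - a) + C * (norm (y - a))\<^sup>2\<close>.

  It remains to prove the first-order condition for such a minimax problem with locally Lipschitz
  \<open>f i\<close> and a closed set \<open>S\<close> (\<open>limiting_multiplier_rule\<close>).  Instead of calculus rules for maxima and
  sums, a penalization decouples the data: every function gets its own copy of the variable, the
  maximum is replaced by the smooth log-sum-exp function, and quadratic penalties tie the copies to a point
  of \<open>S\<close>.  At a minimizer, stationarity in one copy yields a regular subgradient of one function,
  stationarity in the point of \<open>S\<close> yields a regular normal, and the derivatives of log-sum-exp are
  the multipliers.  Letting the penalty grow gives the limiting objects.
\<close>

section \<open>Regular normals and regular subgradients\<close>

text \<open>
  The quotient in the definition is awkward to add and compose; the first-order inequality without
  division is the form in which regular normals are produced and consumed below.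
\<close>

lemma regular_normal_cone_iff:
  "v \<in> regular_normal_cone S x \<longleftrightarrow>
     x \<in> S \<and> (\<forall>\<epsilon>>0. \<forall>\<^sub>F y in at x within S. v \<bullet> (y - x) \<le> \<epsilon> * norm (y - x))"
proof -
  let ?q = "\<lambda>y. v \<bullet> (y - x) / norm (y - x)"
  have ne: "\<forall>\<^sub>F y in at x within S. y \<noteq> x"
    by (simp add: eventually_at_filter)
  have "Limsup (at x within S) (\<lambda>y. ereal (?q y)) \<le> 0
      \<longleftrightarrow> (\<forall>\<epsilon>>0. \<forall>\<^sub>F y in at x within S. v \<bullet> (y - x) \<le> \<epsilon> * norm (y - x))"
    unfolding Limsup_le_iff
  proof safe
    fix \<epsilon> :: real
    assume *: "\<forall>y>0. \<forall>\<^sub>F z in at x within S. ereal (?q z) < y" and "\<epsilon> > 0"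
    from *[rule_format, of "ereal \<epsilon>"] \<open>\<epsilon> > 0\<close>
    have "\<forall>\<^sub>F z in at x within S. ereal (?q z) < ereal \<epsilon>" by simp
    with ne show "\<forall>\<^sub>F y in at x within S. v \<bullet> (y - x) \<le> \<epsilon> * norm (y - x)"
      by eventually_elim (simp add: field_simps)
  next
    fix c :: ereal
    assume *: "\<forall>\<epsilon>>0. \<forall>\<^sub>F y in at x within S. v \<bullet> (y - x) \<le> \<epsilon> * norm (y - x)" and "0 < c"
    obtain \<epsilon> where \<epsilon>: "0 < ereal \<epsilon>" "ereal \<epsilon> < c" using ereal_dense2[OF \<open>0 < c\<close>] by auto
    then have "\<forall>\<^sub>F y in at x within S. v \<bullet> (y - x) \<le> \<epsilon> * norm (y - x)" using * by simp
    with ne show "\<forall>\<^sub>F y in at x within S. ereal (?q y) < c"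
    proof eventually_elim
      case (elim y)
      then have "ereal (?q y) \<le> ereal \<epsilon>" by (simp add: field_simps)
      with \<epsilon> show ?case by (rule_tac le_less_trans)
    qed
  qed
  then show ?thesis by (auto simp: regular_normal_cone_def)
qed

text \<open>
  The Frechet subdifferential of a real-valued function, described without its epigraph.  All the
  calculus is done with this notion, and epigraphs enter only through
  \<open>regular_subgradient_imp_normal_epi\<close> and \<open>limiting_subdifferentialI\<close>.
\<close>

definition regular_subgradient :: "('a::real_inner \<Rightarrow> real) \<Rightarrow> 'a \<Rightarrow> 'a \<Rightarrow> bool" where
  "regular_subgradient \<phi> x v \<longleftrightarrow>
     (\<forall>\<epsilon>>0. \<forall>\<^sub>F y in at x. \<phi> x + v \<bullet> (y - x) - \<epsilon> * norm (y - x) \<le> \<phi> y)"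

lemma regular_subgradientD:
  assumes "regular_subgradient \<phi> x v" and "\<epsilon> > 0"
  shows "\<forall>\<^sub>F y in at x. \<phi> x + v \<bullet> (y - x) - \<epsilon> * norm (y - x) \<le> \<phi> y"
  using assms by (simp add: regular_subgradient_def)

text \<open>
  A point \<open>(y, \<alpha>)\<close> of the epigraph has \<open>\<phi> y \<le> \<alpha>\<close>, so the first-order minorant of \<open>\<phi>\<close> bounds
  \<open>(v, -1) \<bullet> ((y, \<alpha>) - (x, \<phi> x))\<close> by \<open>\<epsilon> * norm (y - x)\<close>, hence by \<open>\<epsilon>\<close> times the norm in the product
  space.
\<close>

lemma regular_subgradient_imp_normal_epi:
  fixes \<phi> :: "'a::real_inner \<Rightarrow> ereal"
  assumes "\<And>y. \<phi> y \<noteq> -\<infinity>" and fin: "\<bar>\<phi> x\<bar> \<noteq> \<infinity>"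
    and sub: "regular_subgradient (\<lambda>y. real_of_ereal (\<phi> y)) x v"
  shows "(v, -1) \<in> regular_normal_cone (epi \<phi>) (x, real_of_ereal (\<phi> x))"
  unfolding regular_normal_cone_iff
proof (intro conjI allI impI)
  let ?F = "\<lambda>y. real_of_ereal (\<phi> y)"
  show "(x, ?F x) \<in> epi \<phi>" using fin by (auto simp: epi_def ereal_real')
  fix \<epsilon> :: real assume "\<epsilon> > 0"
  with sub have "\<forall>\<^sub>F y in at x. ?F x + v \<bullet> (y - x) - \<epsilon> * norm (y - x) \<le> ?F y"
    unfolding regular_subgradient_def by blast
  then have "\<forall>\<^sub>F y in nhds x. ?F x + v \<bullet> (y - x) - \<epsilon> * norm (y - x) \<le> ?F y"
    unfolding eventually_at_filter by eventually_elim auto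
  moreover have "filterlim fst (nhds x) (at (x, ?F x) within epi \<phi>)"
    by (auto intro!: tendsto_eq_intros)
  ultimately have "\<forall>\<^sub>F q in at (x, ?F x) within epi \<phi>.
      ?F x + v \<bullet> (fst q - x) - \<epsilon> * norm (fst q - x) \<le> ?F (fst q)"
    by (rule eventually_compose_filterlim)
  moreover have "\<forall>\<^sub>F q in at (x, ?F x) within epi \<phi>. q \<in> epi \<phi>"
    by (simp add: eventually_at_filter)
  ultimately show "\<forall>\<^sub>F q in at (x, ?F x) within epi \<phi>.
      (v, -1) \<bullet> (q - (x, ?F x)) \<le> \<epsilon> * norm (q - (x, ?F x))"
  proof eventually_elim
    case (elim q)
    obtain y \<alpha> where q: "q = (y, \<alpha>)" by (cases q)
    have "?F y \<le> \<alpha>" using elim(2) assms(1)[of y] by (cases "\<phi> y") (auto simp: epi_def q)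
    moreover have "norm (y - x) \<le> norm (q - (x, ?F x))"
      using norm_fst_le[of "y - x" "\<alpha> - ?F x"] by (simp add: q)
    then have "\<epsilon> * norm (y - x) \<le> \<epsilon> * norm (q - (x, ?F x))" using \<open>\<epsilon> > 0\<close> by simp
    ultimately show ?case using elim(1) by (simp add: q)
  qed
qed

text \<open>
  Continuity of \<open>\<phi>\<close> at \<open>x\<close> is what makes the points \<open>(z k, \<phi> (z k))\<close> of the graph converge to
  \<open>(x, \<phi> x)\<close>.
\<close>

lemma limiting_subdifferentialI:
  fixes \<phi> :: "'a::real_inner \<Rightarrow> ereal"
  assumes "\<And>y. \<phi> y \<noteq> -\<infinity>" and "\<bar>\<phi> x\<bar> \<noteq> \<infinity>"
    and "\<And>k::nat. \<bar>\<phi> (z k)\<bar> \<noteq> \<infinity>"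
    and "\<And>k. regular_subgradient (\<lambda>y. real_of_ereal (\<phi> y)) (z k) (v k)"
    and "z \<longlonglongrightarrow> x" and "v \<longlonglongrightarrow> w" and "isCont (\<lambda>y. real_of_ereal (\<phi> y)) x"
  shows "w \<in> limiting_subdifferential \<phi> x"
proof -
  let ?F = "\<lambda>y. real_of_ereal (\<phi> y)"
  have "(\<lambda>k. (z k, ?F (z k))) \<longlonglongrightarrow> (x, ?F x)"
    using assms by (intro tendsto_Pair isCont_tendsto_compose[of x ?F])
  moreover have "(\<lambda>k. (v k, -1)) \<longlonglongrightarrow> (w, -1::real)"
    using assms by (intro tendsto_intros)
  moreover have "(v k, -1) \<in> regular_normal_cone (epi \<phi>) (z k, ?F (z k))" for k
    using assms by (intro regular_subgradient_imp_normal_epi) auto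
  moreover have "(x, ?F x) \<in> epi \<phi>" using assms(2) by (auto simp: epi_def ereal_real')
  ultimately show ?thesis
    using assms(2) unfolding limiting_subdifferential_def limiting_normal_cone_def
    by (simp, intro exI[of _ "\<lambda>k. (z k, ?F (z k))"] exI[of _ "\<lambda>k. (v k, -1)"])
       (simp add: regular_normal_cone_def)
qed

lemma GDERIV_remainder:
  fixes q :: "'a::real_inner \<Rightarrow> real"
  assumes "GDERIV q x :> w" and "\<epsilon> > 0"
  shows "\<forall>\<^sub>F y in nhds x. \<bar>q y - q x - w \<bullet> (y - x)\<bar> \<le> \<epsilon> * norm (y - x)"
  using assms unfolding gderiv_def has_derivative_at_alt eventually_nhds_metric
  by (auto simp: dist_norm inner_commute)

lemma regular_subgradient_diff_smooth:
  assumes "regular_subgradient (\<lambda>y. \<phi> y + q y) x v" and "GDERIV q x :> w"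
  shows "regular_subgradient \<phi> x (v - w)"
  unfolding regular_subgradient_def
proof (intro allI impI)
  fix \<epsilon> :: real assume "\<epsilon> > 0"
  have "\<forall>\<^sub>F y in at x. \<bar>q y - q x - w \<bullet> (y - x)\<bar> \<le> \<epsilon> / 2 * norm (y - x)"
    using GDERIV_remainder[OF assms(2), of "\<epsilon> / 2"] \<open>\<epsilon> > 0\<close>
    by (auto simp: eventually_at_filter elim: eventually_mono)
  moreover have "\<forall>\<^sub>F y in at x. (\<phi> x + q x) + v \<bullet> (y - x) - \<epsilon> / 2 * norm (y - x) \<le> \<phi> y + q y"
    by (rule regular_subgradientD[OF assms(1)]) (use \<open>\<epsilon> > 0\<close> in simp)
  ultimately show "\<forall>\<^sub>F y in at x. \<phi> x + (v - w) \<bullet> (y - x) - \<epsilon> * norm (y - x) \<le> \<phi> y"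
  proof eventually_elim
    case (elim y)
    have "\<epsilon> / 2 * norm (y - x) + \<epsilon> / 2 * norm (y - x) = \<epsilon> * norm (y - x)" by simp
    then show ?case using elim unfolding inner_diff_left abs_le_iff by linarith
  qed
qed

lemma local_minimizer_regular_subgradient_zero:
  assumes "\<forall>\<^sub>F y in at x. \<phi> x \<le> \<phi> y"
  shows "regular_subgradient \<phi> x 0"
  unfolding regular_subgradient_def
proof (intro allI impI)
  fix \<epsilon> :: real assume "\<epsilon> > 0"
  show "\<forall>\<^sub>F y in at x. \<phi> x + 0 \<bullet> (y - x) - \<epsilon> * norm (y - x) \<le> \<phi> y"
    using assms
  proof eventually_elim
    case (elim y)
    have "0 \<le> \<epsilon> * norm (y - x)" using \<open>\<epsilon> > 0\<close> by simp
    then show ?case using elim unfolding inner_zero_left by linarith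
  qed
qed

text \<open>
  The chain rule read backwards: near \<open>x\<close> the Lipschitz bound turns the remainder of \<open>\<theta>\<close> at \<open>\<phi> x\<close>
  into \<open>o(norm (y - x))\<close>, so a first-order minorant of \<open>\<theta> \<circ> \<phi>\<close> divides by \<open>c > 0\<close> to one of \<open>\<phi>\<close>.
\<close>

lemma regular_subgradient_cancel_outer:
  fixes \<theta> :: "real \<Rightarrow> real"
  assumes sub: "regular_subgradient (\<lambda>y. \<theta> (\<phi> y)) x v"
    and deriv: "(\<theta> has_real_derivative c) (at (\<phi> x))" and "c > 0"
    and lip: "\<forall>\<^sub>F y in nhds x. \<bar>\<phi> y - \<phi> x\<bar> \<le> L * norm (y - x)" and "L \<ge> 0"
  shows "regular_subgradient \<phi> x (v /\<^sub>R c)"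
  unfolding regular_subgradient_def
proof (intro allI impI)
  fix \<epsilon> :: real assume "\<epsilon> > 0"
  \<comment> \<open>half of the budget \<open>\<epsilon> * c\<close> pays for the remainder of \<open>\<theta>\<close>, which is at most \<open>\<delta> * L * norm (y - x)\<close>\<close>
  define \<delta> where "\<delta> = \<epsilon> * c / (2 * (L + 1))"
  have "\<delta> > 0" using \<open>\<epsilon> > 0\<close> \<open>c > 0\<close> \<open>L \<ge> 0\<close> by (simp add: \<delta>_def)
  have "(\<phi> \<longlongrightarrow> \<phi> x) (nhds x)"
  proof (rule Lim_null[THEN iffD2], rule Lim_null_comparison)
    show "\<forall>\<^sub>F y in nhds x. norm (\<phi> y - \<phi> x) \<le> L * norm (y - x)" using lip by simp
    have "((\<lambda>y. L * norm (y - x)) \<longlongrightarrow> L * norm (x - x)) (nhds x)"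
      by (intro tendsto_intros filterlim_ident)
    then show "((\<lambda>y. L * norm (y - x)) \<longlongrightarrow> 0) (nhds x)" by simp
  qed
  moreover have "GDERIV \<theta> (\<phi> x) :> c"
    using deriv by (simp add: gderiv_def has_field_derivative_def inner_real_def[abs_def] mult.commute)
  ultimately have "\<forall>\<^sub>F y in nhds x.
      \<bar>\<theta> (\<phi> y) - \<theta> (\<phi> x) - c \<bullet> (\<phi> y - \<phi> x)\<bar> \<le> \<delta> * norm (\<phi> y - \<phi> x)"
    using eventually_compose_filterlim[OF GDERIV_remainder[OF _ \<open>\<delta> > 0\<close>]] by blast
  then have "\<forall>\<^sub>F y in at x.
      \<bar>\<theta> (\<phi> y) - \<theta> (\<phi> x) - c * (\<phi> y - \<phi> x)\<bar> \<le> \<delta> * \<bar>\<phi> y - \<phi> x\<bar>"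
    by (auto simp: eventually_at_filter elim: eventually_mono)
  moreover have "\<forall>\<^sub>F y in at x. \<bar>\<phi> y - \<phi> x\<bar> \<le> L * norm (y - x)"
    using lip by (auto simp: eventually_at_filter elim: eventually_mono)
  moreover have "\<forall>\<^sub>F y in at x. \<theta> (\<phi> x) + v \<bullet> (y - x) - \<epsilon> * c / 2 * norm (y - x) \<le> \<theta> (\<phi> y)"
    by (rule regular_subgradientD[OF sub]) (use \<open>\<epsilon> > 0\<close> \<open>c > 0\<close> in simp)
  ultimately show "\<forall>\<^sub>F y in at x. \<phi> x + (v /\<^sub>R c) \<bullet> (y - x) - \<epsilon> * norm (y - x) \<le> \<phi> y"
  proof eventually_elim
    case (elim y)
    have "\<delta> * \<bar>\<phi> y - \<phi> x\<bar> \<le> \<delta> * (L * norm (y - x))"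
      using elim(2) \<open>\<delta> > 0\<close> by simp
    also have "\<dots> \<le> \<delta> * ((L + 1) * norm (y - x))"
      using \<open>\<delta> > 0\<close> by (intro mult_left_mono mult_right_mono) auto
    also have "\<dots> = \<epsilon> * c / 2 * norm (y - x)"
      using \<open>L \<ge> 0\<close> by (simp add: \<delta>_def field_simps)
    finally have "v \<bullet> (y - x) - \<epsilon> * c * norm (y - x) \<le> c * (\<phi> y - \<phi> x)"
      using elim(1,3) by (simp add: abs_le_iff)
    then have "(v \<bullet> (y - x) - \<epsilon> * c * norm (y - x)) / c \<le> \<phi> y - \<phi> x"
      using \<open>c > 0\<close> by (simp add: field_simps)
    moreover have "(v \<bullet> (y - x) - \<epsilon> * c * norm (y - x)) / c
        = (v /\<^sub>R c) \<bullet> (y - x) - \<epsilon> * norm (y - x)"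
      using \<open>c > 0\<close> by (simp add: field_simps)
    ultimately show ?case by linarith
  qed
qed

text \<open>
  Moving from \<open>x\<close> a short way in the direction \<open>v\<close> itself, the minorant grows at rate \<open>norm v\<close> and
  \<open>\<phi>\<close> grows at rate at most \<open>L\<close>.
\<close>

lemma regular_subgradient_norm_le:
  fixes \<phi> :: "'a::real_inner \<Rightarrow> real"
  assumes sub: "regular_subgradient \<phi> x v"
    and lip: "\<forall>\<^sub>F y in nhds x. \<bar>\<phi> y - \<phi> x\<bar> \<le> L * norm (y - x)" and "L \<ge> 0"
  shows "norm v \<le> L"
proof (cases "v = 0")
  case False
  show ?thesis
  proof (rule field_le_epsilon)
    fix \<epsilon> :: real assume "\<epsilon> > 0"
    have "\<forall>\<^sub>F y in nhds x. \<phi> x + v \<bullet> (y - x) - \<epsilon> * norm (y - x) \<le> \<phi> y"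
      using sub \<open>\<epsilon> > 0\<close> unfolding regular_subgradient_def eventually_at_filter
      by (auto elim!: allE[of _ \<epsilon>] elim: eventually_mono)
    with lip have "\<forall>\<^sub>F y in nhds x. v \<bullet> (y - x) \<le> (L + \<epsilon>) * norm (y - x)"
      by eventually_elim (simp add: algebra_simps abs_le_iff)
    moreover have "((\<lambda>t. x + t *\<^sub>R v) \<longlongrightarrow> x) (at_right 0)"
      by (auto intro!: tendsto_eq_intros)
    ultimately have "\<forall>\<^sub>F t in at_right 0. v \<bullet> (x + t *\<^sub>R v - x) \<le> (L + \<epsilon>) * norm (x + t *\<^sub>R v - x)"
      by (rule eventually_compose_filterlim)
    with eventually_at_right_less[of "0::real"]
    have "\<forall>\<^sub>F t::real in at_right 0. norm v \<le> L + \<epsilon>"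
    proof eventually_elim
      case (elim t)
      then have "norm v * (t * norm v) \<le> (L + \<epsilon>) * (t * norm v)"
        by (simp add: dot_square_norm power2_eq_square mult_ac)
      then show ?case using elim(1) False by (simp add: mult_le_cancel_right)
    qed
    then show "norm v \<le> L + \<epsilon>" by simp
  qed
qed (use \<open>L \<ge> 0\<close> in simp)

lemma minimizer_neg_gradient_normal:
  assumes "s \<in> S" and "\<forall>\<^sub>F y in at s within S. q s \<le> q y" and "GDERIV q s :> w"
  shows "- w \<in> regular_normal_cone S s"
  unfolding regular_normal_cone_iff
proof (intro conjI allI impI)
  fix \<epsilon> :: real assume "\<epsilon> > 0"
  have "\<forall>\<^sub>F y in at s within S. \<bar>q y - q s - w \<bullet> (y - s)\<bar> \<le> \<epsilon> * norm (y - s)"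
    using GDERIV_remainder[OF assms(3) \<open>\<epsilon> > 0\<close>]
    by (auto simp: eventually_at_filter elim: eventually_mono)
  with assms(2) show "\<forall>\<^sub>F y in at s within S. - w \<bullet> (y - s) \<le> \<epsilon> * norm (y - s)"
    by eventually_elim (simp add: abs_le_iff)
qed (use assms in simp)

lemma GDERIV_half_sq_dist: "GDERIV (\<lambda>y. c * (norm (y - a))\<^sup>2) x :> (2 * c) *\<^sub>R (x - a)"
  unfolding gderiv_def power2_norm_eq_inner
  by (rule derivative_eq_intros refl | simp add: fun_eq_iff inner_commute algebra_simps)+

section \<open>A multiplier rule for minimax problems\<close>

text \<open>
  A smooth substitute for the maximum, which it exceeds by at most \<open>ln CARD('m) / p\<close>.  Its partial derivatives are positive and sum to one; they are the approximate
  multipliers.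
\<close>

definition log_sum_exp :: "real \<Rightarrow> ('m::finite \<Rightarrow> real) \<Rightarrow> real" where
  "log_sum_exp p t = ln (\<Sum>i\<in>UNIV. exp (p * t i)) / p"

lemma sum_exp_pos: "0 < (\<Sum>i\<in>UNIV. exp (t i :: real))" for t :: "'m::finite \<Rightarrow> real"
  by (intro sum_pos) auto

lemma le_log_sum_exp:
  assumes "p > 0"
  shows "t i \<le> log_sum_exp p t"
proof -
  have "exp (p * t i) \<le> (\<Sum>i\<in>UNIV. exp (p * t i))"
    by (rule member_le_sum) auto
  then have "p * t i \<le> ln (\<Sum>i\<in>UNIV. exp (p * t i))"
    by (subst ln_ge_iff) (auto simp: sum_exp_pos)
  then show ?thesis using assms by (simp add: log_sum_exp_def field_simps)
qed

lemma log_sum_exp_zero: "log_sum_exp p (\<lambda>i::'m::finite. 0) = ln (real CARD('m)) / p"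
  by (simp add: log_sum_exp_def)

lemma log_sum_exp_partial_derivative:
  assumes "p > 0"
  shows "((\<lambda>\<tau>. log_sum_exp p (t(i := \<tau>)))
          has_real_derivative exp (p * t i) / (\<Sum>j\<in>UNIV. exp (p * t j))) (at (t i))"
proof -
  have split: "(\<Sum>j\<in>UNIV. exp (p * (t(i := \<tau>)) j)) = exp (p * \<tau>) + (\<Sum>j\<in>UNIV - {i}. exp (p * t j))" for \<tau>
    by (subst sum.remove[of UNIV i]) auto
  have "(\<Sum>j\<in>UNIV. exp (p * t j)) = exp (p * t i) + (\<Sum>j\<in>UNIV - {i}. exp (p * t j))"
    by (subst sum.remove[of UNIV i]) auto
  then show ?thesis
    unfolding log_sum_exp_def split using sum_exp_pos[of "\<lambda>j. p * t j"] assms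
    by (auto intro!: derivative_eq_intros)
qed

text \<open>
  Each \<open>\<phi> i\<close> gets its own copy \<open>z $ i\<close> of the variable, and the quadratic penalty ties the copies to
  the point \<open>s\<close> that carries the constraint.  Stationarity in \<open>z $ i\<close> then involves \<open>\<phi> i\<close> alone and
  stationarity in \<open>s\<close> involves the constraint set alone, so that no sum rule is needed.  The last
  term pulls minimizers towards \<open>a\<close>.
\<close>

definition penalized_max ::
    "('m::finite \<Rightarrow> 'a::real_inner \<Rightarrow> real) \<Rightarrow> 'a \<Rightarrow> real \<Rightarrow> 'a^'m \<Rightarrow> 'a \<Rightarrow> real" where
  "penalized_max \<phi> a p z s =
     log_sum_exp p (\<lambda>i. \<phi> i (z $ i)) + p / 2 * (\<Sum>i\<in>UNIV. (norm (z $ i - s))\<^sup>2)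
       + 1 / 2 * (norm (s - a))\<^sup>2"

text \<open>
  A minimizer exists by compactness.  For the estimate, compare with all variables equal to \<open>a\<close>, where
  the value is \<open>ln CARD('m) / p\<close>.  From below, some \<open>\<phi> i s\<close> is nonnegative, hence
  \<open>\<phi> i (z $ i) \<ge> - L * norm (z $ i - s)\<close>, and half of the penalty absorbs this negative term up to
  \<open>L\<^sup>2 / p\<close>.  The estimate forces \<open>s\<close> and all \<open>z $ i\<close> to \<open>a\<close> as \<open>p\<close> grows.
\<close>

lemma penalized_max_minimizer:
  fixes S :: "'a::euclidean_space set" and \<phi> :: "'m::finite \<Rightarrow> 'a \<Rightarrow> real"
  assumes "closed S" and "a \<in> S" and "r > 0" and "p > 0"
    and lip: "\<And>i. L-lipschitz_on (cball a r) (\<phi> i)" and zero: "\<And>i. \<phi> i a = 0"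
    and min: "\<And>y. y \<in> S \<Longrightarrow> y \<in> cball a r \<Longrightarrow> \<exists>i. 0 \<le> \<phi> i y"
  obtains z :: "'a^'m" and s where "s \<in> S \<inter> cball a r" and "z \<in> cball (\<chi> i. a) r"
    and "\<forall>z'\<in>cball (\<chi> i. a) r. \<forall>s'\<in>S \<inter> cball a r.
           penalized_max \<phi> a p z s \<le> penalized_max \<phi> a p z' s'"
    and "p / 4 * (\<Sum>i\<in>UNIV. (norm (z $ i - s))\<^sup>2) + 1 / 2 * (norm (s - a))\<^sup>2
           \<le> (ln (real CARD('m)) + real CARD('m) * L\<^sup>2) / p"
proof -
  let ?K = "cball (\<chi> i::'m. a) r \<times> (S \<inter> cball a r)"
  let ?J = "\<lambda>q. penalized_max \<phi> a p (fst q) (snd q)"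
  have in_ball: "z $ i \<in> cball a r" if "z \<in> cball (\<chi> i. a) r" for z :: "'a^'m" and i
    using that dist_vec_nth_le[of "\<chi> i::'m. a" i z] by simp
  have base: "((\<chi> i. a), a) \<in> ?K" using \<open>a \<in> S\<close> \<open>r > 0\<close> by simp
  have "compact ?K"
    using \<open>closed S\<close> by (intro compact_Times closed_Int_compact compact_cball)
  moreover have "continuous_on ?K (\<lambda>q. \<phi> i (fst q $ i))" for i
    by (rule continuous_on_compose2[OF lipschitz_on_continuous_on[OF lip[of i]]])
       (use in_ball in \<open>auto intro!: continuous_intros\<close>)
  then have "continuous_on ?K ?J"
    unfolding penalized_max_def log_sum_exp_def using \<open>p > 0\<close>
    by (intro continuous_intros ballI less_imp_neq[OF sum_exp_pos, symmetric]) auto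
  ultimately obtain q where q: "q \<in> ?K" "\<And>q'. q' \<in> ?K \<Longrightarrow> ?J q \<le> ?J q'"
    using continuous_attains_inf[of ?K ?J] base by blast
  obtain z s where zs: "q = (z, s)" by (cases q)
  let ?A = "\<Sum>i\<in>UNIV. (norm (z $ i - s))\<^sup>2"
  have "L \<ge> 0" using lip lipschitz_on_nonneg by blast
  have s: "s \<in> S \<inter> cball a r" and z: "z \<in> cball (\<chi> i. a) r" using q(1) zs by auto
  obtain i where i: "0 \<le> \<phi> i s" using min s by blast
  have "dist (\<phi> i s) (\<phi> i (z $ i)) \<le> L * dist s (z $ i)"
    using lipschitz_onD[OF lip, of s "z $ i" i] s in_ball[OF z] by auto
  then have "- L * norm (z $ i - s) \<le> \<phi> i (z $ i)"
    using i by (simp add: dist_norm norm_minus_commute abs_le_iff)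
  also have "\<dots> \<le> log_sum_exp p (\<lambda>i. \<phi> i (z $ i))"
    using le_log_sum_exp[OF \<open>p > 0\<close>, of "\<lambda>i. \<phi> i (z $ i)" i] by simp
  finally have low: "- L * norm (z $ i - s) \<le> log_sum_exp p (\<lambda>i. \<phi> i (z $ i))" .
  have "L * norm (z $ i - s) \<le> p / 4 * (norm (z $ i - s))\<^sup>2 + L\<^sup>2 / p"
  proof -
    \<comment> \<open>completing the square in \<open>norm (z $ i - s)\<close>\<close>
    have "0 \<le> (p / 2 * norm (z $ i - s) - L)\<^sup>2 / p" using \<open>p > 0\<close> by simp
    also have "\<dots> = p / 4 * (norm (z $ i - s))\<^sup>2 + L\<^sup>2 / p - L * norm (z $ i - s)"
      using \<open>p > 0\<close> by (simp add: power2_eq_square field_simps)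
    finally show ?thesis by simp
  qed
  also have "(norm (z $ i - s))\<^sup>2 \<le> ?A"
    by (rule member_le_sum) auto
  finally have "L * norm (z $ i - s) \<le> p / 4 * ?A + L\<^sup>2 / p"
    using \<open>p > 0\<close> by simp
  moreover have "?J (z, s) \<le> ?J ((\<chi> i. a), a)" using q(2)[OF base] zs by simp
  then have "log_sum_exp p (\<lambda>i. \<phi> i (z $ i)) + p / 2 * ?A + 1 / 2 * (norm (s - a))\<^sup>2
      \<le> ln (real CARD('m)) / p"
    by (simp add: penalized_max_def zero log_sum_exp_zero)
  moreover have "L\<^sup>2 / p \<le> real CARD('m) * L\<^sup>2 / p"
  proof -
    have "1 * L\<^sup>2 \<le> real CARD('m) * L\<^sup>2" by (intro mult_right_mono) (auto simp: Suc_leI)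
    then show ?thesis using \<open>p > 0\<close> by (simp add: divide_right_mono)
  qed
  ultimately have "p / 4 * ?A + 1 / 2 * (norm (s - a))\<^sup>2
      \<le> (ln (real CARD('m)) + real CARD('m) * L\<^sup>2) / p"
    using low by (simp add: add_divide_distrib)
  with s z q zs show ?thesis by (intro that[of s z]) fastforce+
qed

lemma GDERIV_penalty:
  fixes z :: "'m::finite \<Rightarrow> 'a::real_inner"
  shows "GDERIV (\<lambda>y. p / 2 * (\<Sum>i\<in>UNIV. (norm (z i - y))\<^sup>2) + 1 / 2 * (norm (y - a))\<^sup>2) s
           :> (\<Sum>i\<in>UNIV. p *\<^sub>R (s - z i)) + (s - a)"
proof -
  have "GDERIV (\<lambda>y. (\<Sum>i\<in>UNIV. p / 2 * (norm (y - z i))\<^sup>2) + 1 / 2 * (norm (y - a))\<^sup>2) s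
      :> (\<Sum>i\<in>UNIV. (2 * (p / 2)) *\<^sub>R (s - z i)) + (2 * (1 / 2)) *\<^sub>R (s - a)"
    unfolding gderiv_def inner_add_right inner_sum_right
    by (intro has_derivative_add has_derivative_sum GDERIV_half_sq_dist[unfolded gderiv_def])
  then show ?thesis by (simp add: sum_distrib_left norm_minus_commute)
qed

text \<open>
  The multiplier rule for minimizing the maximum of the \<open>\<phi> i\<close> over \<open>S\<close>, up to an error \<open>\<delta>\<close>.  At a
  minimizer of the penalized function with large \<open>p\<close>, the partial derivatives of the smooth maximum
  serve as multipliers \<open>lam\<close>.  Optimality in \<open>z $ i\<close> makes \<open>- p *\<^sub>R (z $ i - s)\<close> a regular subgradient of
  the composition of \<open>\<phi> i\<close> with the smooth maximum, hence \<open>lam $ i\<close> times a regular subgradient of \<open>\<phi> i\<close>.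
  Optimality in \<open>s\<close> puts the negative gradient of the penalty, which is minus the sum of these vectors
  up to \<open>s - a\<close>, into the regular normal cone.
\<close>

lemma fuzzy_multiplier_rule:
  fixes S :: "'a::euclidean_space set" and \<phi> :: "'m::finite \<Rightarrow> 'a \<Rightarrow> real"
  assumes "closed S" and "a \<in> S" and "r > 0" and "\<delta> > 0"
    and lip: "\<And>i. L-lipschitz_on (cball a r) (\<phi> i)" and zero: "\<And>i. \<phi> i a = 0"
    and min: "\<And>y. y \<in> S \<Longrightarrow> y \<in> cball a r \<Longrightarrow> \<exists>i. 0 \<le> \<phi> i y"
  shows "\<exists>s e (z :: 'a^'m) (v :: 'a^'m) (lam :: real^'m).
      norm (s - a) < \<delta> \<and> norm e < \<delta> \<and> (\<forall>i. norm (z $ i - a) < min \<delta> r)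
      \<and> (\<forall>i. 0 \<le> lam $ i) \<and> (\<Sum>i\<in>UNIV. lam $ i) = 1
      \<and> (\<forall>i. regular_subgradient (\<phi> i) (z $ i) (v $ i)) \<and> (\<forall>i. norm (v $ i) \<le> L)
      \<and> - (\<Sum>i\<in>UNIV. lam $ i *\<^sub>R v $ i) - e \<in> regular_normal_cone S s"
proof -
  define m where "m = real CARD('m)"
  \<comment> \<open>the distance from \<open>z\<close> to the constant vector \<open>a\<close> is at most the sum of \<open>m\<close> distances below
      \<open>2 * \<eta>\<close>, so this \<open>\<eta>\<close> keeps \<open>z\<close> in the interior of its ball\<close>
  define \<eta> where "\<eta> = min \<delta> r / (2 * m)"
  define K where "K = ln m + m * L\<^sup>2"
  \<comment> \<open>large enough for \<open>4 * K / p < \<eta>\<^sup>2\<close>; the summand \<open>1\<close> makes this strict and gives \<open>p \<ge> 1\<close>\<close>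
  define p where "p = 1 + 4 * K / \<eta>\<^sup>2"
  have "L \<ge> 0" using lip lipschitz_on_nonneg by blast
  have "m \<ge> 1" unfolding m_def by (simp add: Suc_leI)
  then have "\<eta> > 0" "K \<ge> 0" using \<open>\<delta> > 0\<close> \<open>r > 0\<close> by (auto simp: \<eta>_def K_def)
  have "2 * m * \<eta> = min \<delta> r" using \<open>m \<ge> 1\<close> by (simp add: \<eta>_def)
  have "1 * \<eta> \<le> m * \<eta>" using \<open>m \<ge> 1\<close> \<open>\<eta> > 0\<close> by (intro mult_right_mono) auto
  then have \<eta>_le: "2 * \<eta> \<le> min \<delta> r" using \<open>2 * m * \<eta> = min \<delta> r\<close> by linarith
  have "p \<ge> 1" using \<open>K \<ge> 0\<close> by (simp add: p_def)
  then have "p > 0" by simp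
  have "p * \<eta>\<^sup>2 = \<eta>\<^sup>2 + 4 * K" using \<open>\<eta> > 0\<close> by (simp add: p_def field_simps)
  then have Kp: "4 * K / p < \<eta>\<^sup>2" using \<open>p > 0\<close> \<open>\<eta> > 0\<close> by (simp add: field_simps)
  obtain z s where s: "s \<in> S \<inter> cball a r" and z: "z \<in> cball (\<chi> i::'m. a) r"
    and opt: "\<forall>z'\<in>cball (\<chi> i. a) r. \<forall>s'\<in>S \<inter> cball a r.
           penalized_max \<phi> a p z s \<le> penalized_max \<phi> a p z' s'"
    and est: "p / 4 * (\<Sum>i\<in>UNIV. (norm (z $ i - s))\<^sup>2) + 1 / 2 * (norm (s - a))\<^sup>2 \<le> K / p"
    unfolding K_def m_def
    by (rule penalized_max_minimizer[OF assms(1-3) \<open>p > 0\<close> lip zero min]; (assumption | (rule that; assumption)))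
  have "0 \<le> p / 4 * (\<Sum>i\<in>UNIV. (norm (z $ i - s))\<^sup>2)"
    using \<open>p > 0\<close> by (intro mult_nonneg_nonneg sum_nonneg) auto
  then have "1 / 2 * (norm (s - a))\<^sup>2 \<le> K / p" using est by linarith
  moreover have "2 * K / p \<le> 4 * K / p" using \<open>K \<ge> 0\<close> \<open>p > 0\<close> by (intro divide_right_mono) auto
  ultimately have "(norm (s - a))\<^sup>2 < \<eta>\<^sup>2" using Kp by simp
  then have sa: "norm (s - a) < \<eta>" using \<open>\<eta> > 0\<close> by (intro power_less_imp_less_base[of _ 2 \<eta>]) auto
  have zs: "norm (z $ i - s) < \<eta>" for i
  proof -
    have "(norm (z $ i - s))\<^sup>2 \<le> (\<Sum>i\<in>UNIV. (norm (z $ i - s))\<^sup>2)"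
      by (rule member_le_sum) auto
    also have "\<dots> \<le> p * (\<Sum>i\<in>UNIV. (norm (z $ i - s))\<^sup>2)"
      using mult_right_mono[OF \<open>p \<ge> 1\<close>, of "\<Sum>i\<in>UNIV. (norm (z $ i - s))\<^sup>2"]
      by (simp add: sum_nonneg)
    also have "\<dots> = 4 * (p / 4 * (\<Sum>i\<in>UNIV. (norm (z $ i - s))\<^sup>2))" by simp
    also have "\<dots> \<le> 4 * (K / p)"
      using est zero_le_power2[of "norm (s - a)"] by linarith
    also have "\<dots> < \<eta>\<^sup>2" using Kp by simp
    finally show ?thesis using \<open>\<eta> > 0\<close> by (intro power_less_imp_less_base[of _ 2 \<eta>]) auto
  qed
  have za: "norm (z $ i - a) < 2 * \<eta>" for i
    using norm_triangle_ineq[of "z $ i - s" "s - a"] zs[of i] sa by simp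
  have z_interior: "z \<in> ball (\<chi> i. a) r"
  proof -
    have "dist (\<chi> i. a) z \<le> (\<Sum>i\<in>UNIV. norm (z $ i - a))"
      unfolding dist_vec_def by (rule order_trans[OF L2_set_le_sum]) (auto simp: dist_norm norm_minus_commute)
    also have "\<dots> < (\<Sum>i\<in>(UNIV::'m set). 2 * \<eta>)"
      using za by (intro sum_strict_mono) auto
    also have "\<dots> \<le> r" using \<open>2 * m * \<eta> = min \<delta> r\<close> by (simp add: m_def mult_ac)
    finally show ?thesis by simp
  qed
  define t where "t = (\<lambda>i. \<phi> i (z $ i))"
  define lam where "lam = (\<chi> i. exp (p * t i) / (\<Sum>j\<in>UNIV. exp (p * t j)))"
  define v where "v = (\<chi> i. (- (p *\<^sub>R (z $ i - s))) /\<^sub>R (lam $ i))"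
  have lam_pos: "0 < lam $ i" for i
    using sum_exp_pos[of "\<lambda>j. p * t j"] by (simp add: lam_def)
  have lam_sum: "(\<Sum>i\<in>UNIV. lam $ i) = 1"
    using sum_exp_pos[of "\<lambda>j. p * t j"] by (simp add: lam_def flip: sum_divide_distrib)
  have loc_lip: "\<forall>\<^sub>F y in nhds (z $ i). \<bar>\<phi> i y - \<phi> i (z $ i)\<bar> \<le> L * norm (y - z $ i)" for i
  proof -
    have "z $ i \<in> ball a r" using za[of i] \<eta>_le by (simp add: dist_norm norm_minus_commute)
    then have "\<forall>\<^sub>F y in nhds (z $ i). y \<in> ball a r"
      by (intro eventually_nhds_in_open) auto
    then show ?thesis
    proof eventually_elim
      case (elim y)
      then show ?case using lipschitz_onD[OF lip, of y "z $ i" i] \<open>z $ i \<in> ball a r\<close>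
        by (auto simp: dist_norm)
    qed
  qed
  have sub: "regular_subgradient (\<phi> i) (z $ i) (v $ i)" for i
  proof -
    let ?upd = "\<lambda>y. \<chi> j. if j = i then y else z $ j"
    let ?\<theta> = "\<lambda>\<tau>. log_sum_exp p (t(i := \<tau>))"
    have "((\<lambda>y. ?upd y) \<longlongrightarrow> ?upd (z $ i)) (at (z $ i))"
    proof (rule tendsto_vec_lambda)
      fix j
      show "((\<lambda>y. if j = i then y else z $ j) \<longlongrightarrow> (if j = i then z $ i else z $ j)) (at (z $ i))"
        by (cases "j = i") auto
    qed
    moreover have "?upd (z $ i) = z" by (simp add: vec_eq_iff)
    ultimately have "\<forall>\<^sub>F y in at (z $ i). ?upd y \<in> ball (\<chi> i. a) r"
      using z_interior by (intro topological_tendstoD) auto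
    then have "\<forall>\<^sub>F y in at (z $ i). ?\<theta> (\<phi> i (z $ i)) + p / 2 * (norm (z $ i - s))\<^sup>2
        \<le> ?\<theta> (\<phi> i y) + p / 2 * (norm (y - s))\<^sup>2"
    proof eventually_elim
      case (elim y)
      then have "penalized_max \<phi> a p z s \<le> penalized_max \<phi> a p (?upd y) s"
        using opt s by auto
      moreover have "(\<lambda>j. \<phi> j (?upd y $ j)) = t(i := \<phi> i y)" by (auto simp: t_def)
      moreover have "t(i := \<phi> i (z $ i)) = (\<lambda>j. \<phi> j (z $ j))" by (auto simp: t_def)
      moreover have "(\<Sum>j\<in>UNIV. (norm (?upd y $ j - s))\<^sup>2)
          = (norm (y - s))\<^sup>2 + (\<Sum>j\<in>UNIV - {i}. (norm (z $ j - s))\<^sup>2)"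
        by (subst sum.remove[of UNIV i]) auto
      moreover have "(\<Sum>j\<in>UNIV. (norm (z $ j - s))\<^sup>2)
          = (norm (z $ i - s))\<^sup>2 + (\<Sum>j\<in>UNIV - {i}. (norm (z $ j - s))\<^sup>2)"
        by (subst sum.remove[of UNIV i]) auto
      ultimately show ?case by (simp add: penalized_max_def distrib_left add_divide_distrib)
    qed
    then have "regular_subgradient (\<lambda>y. ?\<theta> (\<phi> i y) + p / 2 * (norm (y - s))\<^sup>2) (z $ i) 0"
      by (rule local_minimizer_regular_subgradient_zero)
    from regular_subgradient_diff_smooth[OF this GDERIV_half_sq_dist]
    have "regular_subgradient (\<lambda>y. ?\<theta> (\<phi> i y)) (z $ i) (- (p *\<^sub>R (z $ i - s)))" by simp
    moreover have "(?\<theta> has_real_derivative lam $ i) (at (\<phi> i (z $ i)))"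
      using log_sum_exp_partial_derivative[OF \<open>p > 0\<close>, of t i] by (simp add: lam_def t_def)
    ultimately have "regular_subgradient (\<phi> i) (z $ i) ((- (p *\<^sub>R (z $ i - s))) /\<^sub>R (lam $ i))"
      by (rule regular_subgradient_cancel_outer[OF _ _ lam_pos loc_lip \<open>L \<ge> 0\<close>])
    then show ?thesis by (simp add: v_def)
  qed
  have "- ((\<Sum>i\<in>UNIV. p *\<^sub>R (s - z $ i)) + (s - a)) \<in> regular_normal_cone S s"
  proof (rule minimizer_neg_gradient_normal[OF _ _ GDERIV_penalty])
    show "s \<in> S" using s by simp
    have "s \<in> ball a r" using sa \<eta>_le \<open>\<eta> > 0\<close> by (simp add: dist_norm norm_minus_commute)
    then have "\<forall>\<^sub>F y in nhds s. y \<in> ball a r"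
      by (intro eventually_nhds_in_open) auto
    then have "\<forall>\<^sub>F y in at s within S. y \<in> S \<and> y \<in> ball a r"
      by (auto simp: eventually_at_filter elim: eventually_mono)
    then show "\<forall>\<^sub>F y in at s within S.
        p / 2 * (\<Sum>i\<in>UNIV. (norm (z $ i - s))\<^sup>2) + 1 / 2 * (norm (s - a))\<^sup>2
        \<le> p / 2 * (\<Sum>i\<in>UNIV. (norm (z $ i - y))\<^sup>2) + 1 / 2 * (norm (y - a))\<^sup>2"
    proof eventually_elim
      case (elim y)
      then have "penalized_max \<phi> a p z s \<le> penalized_max \<phi> a p z y" using opt z by auto
      then show ?case by (simp add: penalized_max_def)
    qed
  qed
  also have "- ((\<Sum>i\<in>UNIV. p *\<^sub>R (s - z $ i)) + (s - a))
      = - (\<Sum>i\<in>UNIV. lam $ i *\<^sub>R v $ i) - (s - a)"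
  proof -
    have "lam $ i *\<^sub>R v $ i = p *\<^sub>R (s - z $ i)" for i
      using lam_pos[of i] by (simp add: v_def algebra_simps)
    then show ?thesis by simp
  qed
  finally have "- (\<Sum>i\<in>UNIV. lam $ i *\<^sub>R v $ i) - (s - a) \<in> regular_normal_cone S s" .
  moreover have "norm (s - a) < \<delta>" using sa \<eta>_le \<open>\<eta> > 0\<close> by simp
  moreover have "norm (z $ i - a) < min \<delta> r" for i using za[of i] \<eta>_le by linarith
  ultimately show ?thesis
    using lam_pos[THEN less_imp_le] lam_sum sub
      regular_subgradient_norm_le[OF sub loc_lip \<open>L \<ge> 0\<close>]
    by (intro exI[of _ s] exI[of _ "s - a"] exI[of _ z] exI[of _ v] exI[of _ lam]) blast
qed

text \<open>
  The exact multiplier rule, by compactness: the approximate multipliers lie in the simplex and the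
  subgradients are bounded by the Lipschitz constant.
\<close>

lemma limiting_multiplier_rule:
  fixes S :: "'a::euclidean_space set" and \<phi> :: "'m::finite \<Rightarrow> 'a \<Rightarrow> real"
  assumes "closed S" and "a \<in> S" and "r > 0"
    and lip: "\<And>i. L-lipschitz_on (cball a r) (\<phi> i)" and zero: "\<And>i. \<phi> i a = 0"
    and min: "\<And>y. y \<in> S \<Longrightarrow> y \<in> cball a r \<Longrightarrow> \<exists>i. 0 \<le> \<phi> i y"
  shows "\<exists>(lam :: real^'m) (v :: 'a^'m) (Z :: nat \<Rightarrow> 'a^'m) W.
      (\<forall>i. 0 \<le> lam $ i) \<and> (\<Sum>i\<in>UNIV. lam $ i) = 1
      \<and> (\<forall>k i. Z k $ i \<in> ball a r \<and> regular_subgradient (\<phi> i) (Z k $ i) (W k $ i))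
      \<and> (\<forall>i. (\<lambda>k. Z k $ i) \<longlonglongrightarrow> a \<and> (\<lambda>k. W k $ i) \<longlonglongrightarrow> v $ i)
      \<and> - (\<Sum>i\<in>UNIV. lam $ i *\<^sub>R v $ i) \<in> limiting_normal_cone S a"
proof -
  let ?\<delta> = "\<lambda>k. inverse (real (Suc k))"
  have "\<forall>k. \<exists>s e z v lam. norm (s - a) < ?\<delta> k \<and> norm e < ?\<delta> k
      \<and> (\<forall>i. norm (z $ i - a) < min (?\<delta> k) r)
      \<and> (\<forall>i. 0 \<le> lam $ i) \<and> (\<Sum>i\<in>UNIV. lam $ i) = 1
      \<and> (\<forall>i. regular_subgradient (\<phi> i) (z $ i) (v $ i)) \<and> (\<forall>i. norm (v $ i) \<le> L)
      \<and> - (\<Sum>i\<in>UNIV. lam $ i *\<^sub>R v $ i) - e \<in> regular_normal_cone S s"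
    by (intro allI fuzzy_multiplier_rule[OF assms(1-3) _ lip zero min]) simp_all
  then obtain s e and z v :: "nat \<Rightarrow> 'a^'m" and lam :: "nat \<Rightarrow> real^'m" where
    "\<forall>k. norm (s k - a) < ?\<delta> k \<and> norm (e k) < ?\<delta> k
      \<and> (\<forall>i. norm (z k $ i - a) < min (?\<delta> k) r)
      \<and> (\<forall>i. 0 \<le> lam k $ i) \<and> (\<Sum>i\<in>UNIV. lam k $ i) = 1
      \<and> (\<forall>i. regular_subgradient (\<phi> i) (z k $ i) (v k $ i)) \<and> (\<forall>i. norm (v k $ i) \<le> L)
      \<and> - (\<Sum>i\<in>UNIV. lam k $ i *\<^sub>R v k $ i) - e k \<in> regular_normal_cone S (s k)"
    unfolding choice_iff by (elim exE)
  then have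
    *: "\<And>k. norm (s k - a) < ?\<delta> k" "\<And>k. norm (e k) < ?\<delta> k"
      "\<And>k i. norm (z k $ i - a) < min (?\<delta> k) r"
      "\<And>k i. 0 \<le> lam k $ i" "\<And>k. (\<Sum>i\<in>UNIV. lam k $ i) = 1"
      "\<And>k i. regular_subgradient (\<phi> i) (z k $ i) (v k $ i)" "\<And>k i. norm (v k $ i) \<le> L"
      "\<And>k. - (\<Sum>i\<in>UNIV. lam k $ i *\<^sub>R v k $ i) - e k \<in> regular_normal_cone S (s k)"
    by blast+
  have s: "s \<longlonglongrightarrow> a" and z: "(\<lambda>k. z k $ i) \<longlonglongrightarrow> a" for i
    by (rule Lim_null[THEN iffD2], rule Lim_null_comparison[OF _ LIMSEQ_inverse_real_of_nat],
        use *(1) *(3)[of _ i] in \<open>auto intro!: always_eventually less_imp_le\<close>)+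
  have e: "e \<longlonglongrightarrow> 0"
    by (rule Lim_null_comparison[OF _ LIMSEQ_inverse_real_of_nat])
       (use *(2) in \<open>auto intro!: always_eventually less_imp_le\<close>)
  have "norm (v k) \<le> real CARD('m) * L" for k
    unfolding norm_vec_def
    by (rule order_trans[OF L2_set_le_sum]) (use *(7) sum_bounded_above[of UNIV "\<lambda>i. norm (v k $ i)" L] in auto)
  moreover have "norm (lam k) \<le> 1" for k
    using norm_le_l1_cart[of "lam k"] *(4,5) by simp
  ultimately have "norm (lam k, v k) \<le> 1 + real CARD('m) * L" for k
    by (rule_tac order_trans[OF norm_Pair_le]) (rule add_mono)
  then have "bounded (range (\<lambda>k. (lam k, v k)))" by (auto simp: bounded_iff)
  then obtain lv \<rho> where \<rho>: "strict_mono \<rho>" and lv: "((\<lambda>k. (lam k, v k)) \<circ> \<rho>) \<longlonglongrightarrow> lv"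
    using bounded_imp_convergent_subsequence by blast
  define lam' v' where "lam' = fst lv" and "v' = snd lv"
  have lam_lim: "(\<lambda>k. lam (\<rho> k) $ i) \<longlonglongrightarrow> lam' $ i" for i
    using tendsto_vec_nth[OF tendsto_fst[OF lv], of i] by (simp add: lam'_def o_def)
  have v_lim: "(\<lambda>k. v (\<rho> k) $ i) \<longlonglongrightarrow> v' $ i" for i
    using tendsto_vec_nth[OF tendsto_snd[OF lv], of i] by (simp add: v'_def o_def)
  have sub: "(\<lambda>k. X (\<rho> k)) \<longlonglongrightarrow> y" if "X \<longlonglongrightarrow> y" for X :: "nat \<Rightarrow> 'a" and y
    using LIMSEQ_subseq_LIMSEQ[OF that \<rho>] by (simp add: o_def)
  have "(\<lambda>k. \<Sum>i\<in>UNIV. lam (\<rho> k) $ i) \<longlonglongrightarrow> (\<Sum>i\<in>UNIV. lam' $ i)"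
    by (intro tendsto_intros lam_lim)
  then have sum1: "(\<Sum>i\<in>UNIV. lam' $ i) = 1"
    by (simp add: *(5) LIMSEQ_const_iff)
  have "(\<lambda>k. - (\<Sum>i\<in>UNIV. lam (\<rho> k) $ i *\<^sub>R v (\<rho> k) $ i) - e (\<rho> k))
      \<longlonglongrightarrow> - (\<Sum>i\<in>UNIV. lam' $ i *\<^sub>R v' $ i) - 0"
    by (intro tendsto_intros lam_lim v_lim sub[OF e])
  moreover have "s k \<in> S" for k using *(8)[of k] by (simp add: regular_normal_cone_def)
  ultimately have "- (\<Sum>i\<in>UNIV. lam' $ i *\<^sub>R v' $ i) \<in> limiting_normal_cone S a"
    unfolding limiting_normal_cone_def mem_Collect_eq using \<open>a \<in> S\<close> *(8) sub[OF s]
    by (intro conjI exI[of _ "\<lambda>k. s (\<rho> k)"]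
        exI[of _ "\<lambda>k. - (\<Sum>i\<in>UNIV. lam (\<rho> k) $ i *\<^sub>R v (\<rho> k) $ i) - e (\<rho> k)"]) simp_all
  moreover have "0 \<le> lam' $ i" for i
    using LIMSEQ_le_const[OF lam_lim] *(4) by blast
  moreover have "z (\<rho> k) $ i \<in> ball a r" for k i
    using *(3)[of "\<rho> k" i] by (simp add: dist_norm norm_minus_commute)
  ultimately show ?thesis
    by (intro exI[of _ lam'] exI[of _ v'] exI[of _ "\<lambda>k. z (\<rho> k)"] exI[of _ "\<lambda>k. v (\<rho> k)"]
        conjI allI sum1 *(6) sub[OF z] v_lim)
qed

section \<open>Weakly convex functions and functions with Lipschitz gradient\<close>

lemma regular_normal_feasible_direction:
  assumes v: "v \<in> regular_normal_cone S x" and seg: "\<And>t. 0 < t \<Longrightarrow> t < 1 \<Longrightarrow> x + t *\<^sub>R d \<in> S"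
  shows "v \<bullet> d \<le> 0"
proof (cases "d = 0")
  case False
  show ?thesis
  proof (rule field_le_epsilon)
    fix \<epsilon> :: real assume "\<epsilon> > 0"
    define \<delta> where "\<delta> = \<epsilon> / norm d"
    have "\<delta> > 0" using \<open>\<epsilon> > 0\<close> False by (simp add: \<delta>_def)
    have pos: "\<forall>\<^sub>F t::real in at_right 0. 0 < t \<and> t < 1"
      by (rule eventually_at_rightI[of 0 1]) auto
    have "((\<lambda>t. x + t *\<^sub>R d) \<longlongrightarrow> x) (at_right 0)"
      by (auto intro!: tendsto_eq_intros)
    then have "filterlim (\<lambda>t. x + t *\<^sub>R d) (at x within S) (at_right 0)"
      unfolding filterlim_at using pos seg False by (auto elim: eventually_mono)
    moreover have "\<forall>\<^sub>F y in at x within S. v \<bullet> (y - x) \<le> \<delta> * norm (y - x)"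
      using v \<open>\<delta> > 0\<close> unfolding regular_normal_cone_iff by blast
    ultimately have "\<forall>\<^sub>F t in at_right 0. v \<bullet> (x + t *\<^sub>R d - x) \<le> \<delta> * norm (x + t *\<^sub>R d - x)"
      by (rule eventually_compose_filterlim[rotated])
    with pos have "\<forall>\<^sub>F t::real in at_right 0. v \<bullet> d \<le> 0 + \<epsilon>"
    proof eventually_elim
      case (elim t)
      then have "t * (v \<bullet> d) \<le> t * \<epsilon>" using False by (simp add: \<delta>_def)
      then show ?case using elim by simp
    qed
    then show "v \<bullet> d \<le> 0 + \<epsilon>" by simp
  qed
qed simp

text \<open>
  For a real-valued function the extended-valued formulation says exactly this; a point of a segment
  outside \<open>U\<close> would have the value infinity, so convexity of \<open>U\<close> is part of the conclusion.
\<close>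

lemma weakly_convex_on_real_iff:
  fixes h :: "'a::real_normed_vector \<Rightarrow> real"
  shows
  "weakly_convex_on \<beta> U (\<lambda>y. ereal (h y)) \<longleftrightarrow>
     0 \<le> \<beta> \<and> convex_on U (\<lambda>y. h y + \<beta> / 2 * (norm y)\<^sup>2)"
proof -
  define \<psi> where "\<psi> = (\<lambda>y. h y + \<beta> / 2 * (norm y)\<^sup>2)"
  define \<phi> where "\<phi> = (\<lambda>x. ereal (h x) + indicator_infty U x + ereal (\<beta> / 2 * (norm x)\<^sup>2))"
  have in_U: "\<phi> y = ereal (\<psi> y)" if "y \<in> U" for y using that by (simp add: indicator_infty_def \<phi>_def \<psi>_def)
  have out_U: "\<phi> y = \<infinity>" if "y \<notin> U" for y using that by (simp add: indicator_infty_def \<phi>_def \<psi>_def)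
  have "convex_ereal \<phi> \<longleftrightarrow> convex_on U \<psi>"
  proof
    assume conv: "convex_ereal \<phi>"
    have *: "(1 - t) *\<^sub>R x + t *\<^sub>R y \<in> U \<and>
        \<psi> ((1 - t) *\<^sub>R x + t *\<^sub>R y) \<le> (1 - t) * \<psi> x + t * \<psi> y"
      if "x \<in> U" "y \<in> U" "0 < t" "t < 1" for x y t
    proof -
      let ?z = "(1 - t) *\<^sub>R x + t *\<^sub>R y"
      have "\<phi> ?z \<le> ereal (1 - t) * \<phi> x + ereal t * \<phi> y"
        using conv that unfolding convex_ereal_def by blast
      also have "\<dots> = ereal ((1 - t) * \<psi> x + t * \<psi> y)" using that by (simp add: in_U)
      finally have le: "\<phi> ?z \<le> ereal ((1 - t) * \<psi> x + t * \<psi> y)" .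
      then have "?z \<in> U" using out_U[of ?z] by force
      with le show ?thesis by (simp add: in_U)
    qed
    then have "convex U" unfolding convex_alt by (metis add_0 add.right_neutral diff_0_right diff_self le_less scale_one scale_zero_left)
    then show "convex_on U \<psi>" using * by (intro convex_onI) auto
  next
    assume conv: "convex_on U \<psi>"
    show "convex_ereal \<phi>"
      unfolding convex_ereal_def
    proof (intro allI impI)
      fix x y :: 'a and t :: real assume t: "0 < t \<and> t < 1"
      let ?z = "(1 - t) *\<^sub>R x + t *\<^sub>R y"
      show "\<phi> ?z \<le> ereal (1 - t) * \<phi> x + ereal t * \<phi> y"
      proof (cases "x \<in> U \<and> y \<in> U")
        case True
        then have "?z \<in> U" using conv t by (auto simp: convex_on_def convex_alt)
        moreover have "\<psi> ?z \<le> (1 - t) * \<psi> x + t * \<psi> y"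
          using convex_onD[OF conv, of t x y] t True by simp
        ultimately show ?thesis using True by (simp add: in_U)
      next
        case False
        then show ?thesis using t out_U in_U by (cases "x \<in> U"; cases "y \<in> U") auto
      qed
    qed
  qed
  then show ?thesis by (simp add: weakly_convex_on_def \<phi>_def \<psi>_def)
qed

text \<open>
  The term \<open>\<beta> / 2 * (norm y)\<^sup>2\<close> satisfies the convexity inequality with the explicit gap
  \<open>\<beta> / 2 * t * (1 - t) * (norm (y - x))\<^sup>2\<close>, which is what \<open>h\<close> may lose.
\<close>

lemma convex_on_quadratic_segment:
  fixes h :: "'a::real_inner \<Rightarrow> real"
  assumes "convex_on U (\<lambda>y. h y + \<beta> / 2 * (norm y)\<^sup>2)" and "x \<in> U" and "y \<in> U"
    and "0 \<le> t" and "t \<le> 1"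
  shows "h (x + t *\<^sub>R (y - x)) \<le> (1 - t) * h x + t * h y + \<beta> / 2 * t * (1 - t) * (norm (y - x))\<^sup>2"
proof -
  let ?z = "(1 - t) *\<^sub>R x + t *\<^sub>R y"
  have norm_z: "(norm ?z)\<^sup>2 = (1 - t) * (norm x)\<^sup>2 + t * (norm y)\<^sup>2 - t * (1 - t) * (norm (y - x))\<^sup>2"
    unfolding power2_norm_eq_inner
    by (simp add: inner_add_left inner_add_right inner_diff_left inner_diff_right inner_commute algebra_simps power2_eq_square)
  have "(1 - t) * (h x + \<beta> / 2 * (norm x)\<^sup>2) + t * (h y + \<beta> / 2 * (norm y)\<^sup>2) - \<beta> / 2 * (norm ?z)\<^sup>2
      = (1 - t) * h x + t * h y + \<beta> / 2 * t * (1 - t) * (norm (y - x))\<^sup>2"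
    unfolding norm_z by (simp add: field_simps)
  moreover have "h ?z + \<beta> / 2 * (norm ?z)\<^sup>2
      \<le> (1 - t) * (h x + \<beta> / 2 * (norm x)\<^sup>2) + t * (h y + \<beta> / 2 * (norm y)\<^sup>2)"
    using convex_onD[OF assms(1), of t x y] assms by simp
  moreover have "?z = x + t *\<^sub>R (y - x)" by (simp add: algebra_simps)
  ultimately show ?thesis by simp
qed

text \<open>
  At a point \<open>(x', \<alpha>)\<close> of the epigraph with \<open>x'\<close> in \<open>U\<close>, the direction
  \<open>(y - x', h y + \<beta> / 2 * (norm (y - x'))\<^sup>2 - \<alpha>)\<close> stays in the epigraph for all times up to \<open>1\<close>, so a
  regular normal there has nonpositive inner product with it.  This inequality is closed and passes to
  the limit of the normals.
\<close>

lemma weakly_convex_subgradient_inequality: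
  fixes h :: "'a::real_inner \<Rightarrow> real"
  assumes conv: "convex_on U (\<lambda>y. h y + \<beta> / 2 * (norm y)\<^sup>2)" and "0 \<le> \<beta>" and "open U"
    and "x \<in> U" and "y \<in> U" and u: "u \<in> limiting_subdifferential (\<lambda>y. ereal (h y)) x"
  shows "h x + u \<bullet> (y - x) - \<beta> / 2 * (norm (y - x))\<^sup>2 \<le> h y"
proof -
  let ?E = "epi (\<lambda>y. ereal (h y))"
  obtain P W where P: "\<And>k::nat. P k \<in> ?E" and W: "\<And>k. W k \<in> regular_normal_cone ?E (P k)"
    and P_lim: "P \<longlonglongrightarrow> (x, h x)" and W_lim: "W \<longlonglongrightarrow> (u, -1)"
    using u by (auto simp: limiting_subdifferential_def limiting_normal_cone_def)
  let ?d = "\<lambda>k. (y - fst (P k), h y + \<beta> / 2 * (norm (y - fst (P k)))\<^sup>2 - snd (P k))"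
  have "\<forall>\<^sub>F k in sequentially. fst (P k) \<in> U"
    using topological_tendstoD[OF tendsto_fst[OF P_lim], of U] \<open>open U\<close> \<open>x \<in> U\<close> by simp
  then have "\<forall>\<^sub>F k in sequentially. W k \<bullet> ?d k \<le> 0"
  proof eventually_elim
    case (elim k)
    show ?case
    proof (rule regular_normal_feasible_direction[OF W])
      fix t :: real assume t: "0 < t" "t < 1"
      let ?D = "\<beta> / 2 * (norm (y - fst (P k)))\<^sup>2"
      have "h (fst (P k) + t *\<^sub>R (y - fst (P k)))
          \<le> (1 - t) * h (fst (P k)) + t * h y + \<beta> / 2 * t * (1 - t) * (norm (y - fst (P k)))\<^sup>2"
        using convex_on_quadratic_segment[OF conv elim \<open>y \<in> U\<close>] t by simp
      also have "\<beta> / 2 * t * (1 - t) * (norm (y - fst (P k)))\<^sup>2 = t * ((1 - t) * ?D)" by simp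
      also have "\<dots> \<le> t * (1 * ?D)"
        using t \<open>0 \<le> \<beta>\<close> by (intro mult_left_mono mult_right_mono) auto
      also have "h (fst (P k)) \<le> snd (P k)" using P[of k] by (auto simp: epi_def)
      finally have "h (fst (P k) + t *\<^sub>R (y - fst (P k))) \<le> (1 - t) * snd (P k) + t * h y + t * (1 * ?D)"
        using t by simp
      then show "P k + t *\<^sub>R ?d k \<in> ?E"
        by (cases "P k") (simp add: epi_def algebra_simps)
    qed
  qed
  moreover have "(\<lambda>k. W k \<bullet> ?d k) \<longlonglongrightarrow>
      (u, -1) \<bullet> (y - fst (x, h x), h y + \<beta> / 2 * (norm (y - fst (x, h x)))\<^sup>2 - snd (x, h x))"
    by (intro tendsto_intros W_lim P_lim)
  ultimately have "(u, -1) \<bullet> (y - fst (x, h x), h y + \<beta> / 2 * (norm (y - fst (x, h x)))\<^sup>2 - snd (x, h x)) \<le> 0"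
    by (intro tendsto_upperbound[OF _ _ trivial_limit_sequentially])
  then show ?thesis by simp
qed

text \<open>
  The point \<open>x\<close> is a local minimizer of \<open>h\<close> plus the smooth function
  \<open>\<beta> / 2 * (norm (y - x))\<^sup>2 - y \<bullet> u\<close>, whose gradient at \<open>x\<close> is \<open>- u\<close>.
\<close>

lemma regular_subgradient_of_quadratic_minorant:
  assumes "open U" and "x \<in> U"
    and minor: "\<And>y. y \<in> U \<Longrightarrow> h x + u \<bullet> (y - x) - \<beta> / 2 * (norm (y - x))\<^sup>2 \<le> h y"
  shows "regular_subgradient h x u"
proof -
  have "\<forall>\<^sub>F y in at x. y \<in> U" using assms by (intro eventually_at_in_open') auto
  then have "\<forall>\<^sub>F y in at x. (h x - x \<bullet> u) + \<beta> / 2 * (norm (x - x))\<^sup>2 \<le> (h y - y \<bullet> u) + \<beta> / 2 * (norm (y - x))\<^sup>2"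
    by eventually_elim (use minor in \<open>fastforce simp: inner_diff_right inner_commute\<close>)
  then have "\<forall>\<^sub>F y in at x. h x + (\<beta> / 2 * (norm (x - x))\<^sup>2 - x \<bullet> u) \<le> h y + (\<beta> / 2 * (norm (y - x))\<^sup>2 - y \<bullet> u)"
    by eventually_elim simp
  then have min: "regular_subgradient (\<lambda>y. h y + (\<beta> / 2 * (norm (y - x))\<^sup>2 - y \<bullet> u)) x 0"
    by (rule local_minimizer_regular_subgradient_zero)
  have lin: "GDERIV (\<lambda>y. y \<bullet> u) x :> u"
    unfolding gderiv_def by (rule bounded_linear_imp_has_derivative[OF bounded_linear_inner_left])
  have "GDERIV (\<lambda>y. \<beta> / 2 * (norm (y - x))\<^sup>2 - y \<bullet> u) x :> - u"
    using GDERIV_diff[OF GDERIV_half_sq_dist[of "\<beta> / 2" x x] lin] by simp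
  from regular_subgradient_diff_smooth[OF min this] show ?thesis by simp
qed

lemma weakly_convex_continuous_on:
  fixes h :: "'a::euclidean_space \<Rightarrow> real"
  assumes "open U" and "convex_on U (\<lambda>y. h y + \<beta> / 2 * (norm y)\<^sup>2)"
  shows "continuous_on U h"
proof -
  have "continuous_on U (\<lambda>y. (h y + \<beta> / 2 * (norm y)\<^sup>2) - \<beta> / 2 * (norm y)\<^sup>2)"
    by (intro continuous_on_diff convex_on_continuous assms continuous_intros)
  then show ?thesis by simp
qed

text \<open>
  Evaluate the quadratic inequality at a fixed distance \<open>\<delta>\<close> from \<open>xs k\<close> in the direction of \<open>us k\<close>;
  \<open>h\<close> is bounded on a compact ball that contains these points.
\<close>

lemma weakly_convex_subgradients_bounded:
  fixes h :: "'a::euclidean_space \<Rightarrow> real"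
  assumes "open U" and "a \<in> U" and cont: "continuous_on U h" and "xs \<longlonglongrightarrow> a"
    and minor: "\<And>(k::nat) y. y \<in> U \<Longrightarrow>
          h (xs k) + us k \<bullet> (y - xs k) - \<beta> / 2 * (norm (y - xs k))\<^sup>2 \<le> h y"
  shows "bounded (range us)"
proof -
  obtain \<rho> where "\<rho> > 0" and sub: "cball a \<rho> \<subseteq> U"
    using \<open>open U\<close> \<open>a \<in> U\<close> open_contains_cball by blast
  define \<delta> where "\<delta> = \<rho> / 2"
  have "\<delta> > 0" using \<open>\<rho> > 0\<close> by (simp add: \<delta>_def)
  have "compact (h ` cball a \<rho>)"
    by (intro compact_continuous_image continuous_on_subset[OF cont sub] compact_cball)
  then obtain M where "\<forall>y\<in>cball a \<rho>. \<bar>h y\<bar> \<le> M"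
    using compact_imp_bounded[of "h ` cball a \<rho>"] by (auto simp: bounded_iff)
  then have M: "\<bar>h y\<bar> \<le> M" if "y \<in> cball a \<rho>" for y using that by blast
  let ?K = "(2 * M + \<beta> / 2 * \<delta>\<^sup>2) / \<delta>"
  have "\<forall>\<^sub>F k in sequentially. dist (xs k) a < \<delta>"
    using \<open>xs \<longlonglongrightarrow> a\<close> \<open>\<delta> > 0\<close> by (rule tendstoD)
  then have "\<forall>\<^sub>F k in sequentially. norm (us k) \<le> max 1 ?K"
  proof eventually_elim
    case (elim k)
    show ?case
    proof (cases "us k = 0")
      case False
      define y where "y = xs k + (\<delta> / norm (us k)) *\<^sub>R us k"
      have yx: "norm (y - xs k) = \<delta>" using False \<open>\<delta> > 0\<close> by (simp add: y_def)
      have "norm (y - a) \<le> norm (y - xs k) + norm (xs k - a)"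
        using norm_triangle_ineq[of "y - xs k" "xs k - a"] by simp
      then have y: "y \<in> cball a \<rho>"
        using elim yx by (simp add: dist_norm norm_minus_commute \<delta>_def)
      have x: "xs k \<in> cball a \<rho>"
        using elim \<open>\<rho> > 0\<close> by (simp add: dist_commute \<delta>_def)
      have "us k \<bullet> (y - xs k) = \<delta> * norm (us k)"
        using False by (simp add: y_def dot_square_norm power2_eq_square)
      then have "\<delta> * norm (us k) \<le> 2 * M + \<beta> / 2 * \<delta>\<^sup>2"
        using minor[of y k] y sub yx M[OF y] M[OF x] by (auto simp: abs_le_iff)
      then show ?thesis using \<open>\<delta> > 0\<close> by (simp add: field_simps le_max_iff_disj)
    qed simp
  qed
  then have "Bseq us" unfolding Bfun_def by (intro exI[of _ "max 1 ?K"]) auto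
  then show ?thesis by (simp add: Bseq_eq_bounded)
qed

lemma GDERIV_unique:
  assumes "GDERIV q x :> v" and "GDERIV q x :> w"
  shows "v = w"
proof -
  have "(\<lambda>d. d \<bullet> v) = (\<lambda>d. d \<bullet> w)"
    using assms has_derivative_unique unfolding gderiv_def by blast
  then have "(v - w) \<bullet> v = (v - w) \<bullet> w" by metis
  then have "(v - w) \<bullet> (v - w) = 0" by (simp add: inner_diff_right)
  then show ?thesis by simp
qed

lemma GDERIV_gradient:
  fixes \<phi> :: "'a::euclidean_space \<Rightarrow> ereal"
  assumes "(\<lambda>y. real_of_ereal (\<phi> y)) differentiable (at x)"
  shows "GDERIV (\<lambda>y. real_of_ereal (\<phi> y)) x :> gradient \<phi> x"
proof -
  obtain D where D: "((\<lambda>y. real_of_ereal (\<phi> y)) has_derivative D) (at x)"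
    using assms unfolding differentiable_def by blast
  have "D = (\<lambda>d. d \<bullet> adjoint D 1)"
    using adjoint_works[OF has_derivative_linear[OF D], of _ 1] by auto
  then have gd: "GDERIV (\<lambda>y. real_of_ereal (\<phi> y)) x :> adjoint D 1"
    using D unfolding gderiv_def by metis
  show ?thesis
    unfolding gradient_def
    by (rule theI[of "\<lambda>v. GDERIV (\<lambda>y. real_of_ereal (\<phi> y)) x :> v", OF gd GDERIV_unique[OF _ gd]])
qed

text \<open>
  Along the segment, the difference between \<open>\<phi>\<close> and the quadratic upper model has the derivative
  \<open>(gradient \<phi> (x + t *\<^sub>R (y - x)) - gradient \<phi> x) \<bullet> (y - x) - l * t * (norm (y - x))\<^sup>2\<close>, which the
  Lipschitz bound makes nonpositive.
\<close>

lemma descent_lemma: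
  fixes \<phi> :: "'a::euclidean_space \<Rightarrow> ereal"
  assumes "lipschitz_gradient_on l U \<phi>" and "convex U" and "x \<in> U" and "y \<in> U"
  shows "real_of_ereal (\<phi> y)
    \<le> real_of_ereal (\<phi> x) + gradient \<phi> x \<bullet> (y - x) + l / 2 * (norm (y - x))\<^sup>2"
proof -
  let ?G = "\<lambda>y. real_of_ereal (\<phi> y)" and ?d = "y - x"
  let ?p = "\<lambda>t. ?G (x + t *\<^sub>R ?d) - t * (gradient \<phi> x \<bullet> ?d) - l / 2 * t\<^sup>2 * (norm ?d)\<^sup>2"
  have "?p 1 \<le> ?p 0"
  proof (rule DERIV_nonpos_imp_nonincreasing[of 0 1 ?p])
    fix t :: real assume t: "0 \<le> t" "t \<le> 1"
    let ?z = "x + t *\<^sub>R ?d"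
    have "?z = (1 - t) *\<^sub>R x + t *\<^sub>R y" by (simp add: algebra_simps)
    then have z: "?z \<in> U" using assms(2-4) t by (simp add: convex_alt)
    have "(?G has_derivative (\<lambda>d. d \<bullet> gradient \<phi> ?z)) (at ?z)"
      using GDERIV_gradient[of \<phi> ?z] assms(1) z by (simp add: lipschitz_gradient_on_def gderiv_def)
    moreover have "((\<lambda>t. x + t *\<^sub>R ?d) has_derivative (\<lambda>\<tau>. \<tau> *\<^sub>R ?d)) (at t)"
      by (auto intro!: derivative_eq_intros)
    ultimately have "((\<lambda>t. ?G (x + t *\<^sub>R ?d)) has_derivative (\<lambda>\<tau>. (\<tau> *\<^sub>R ?d) \<bullet> gradient \<phi> ?z)) (at t)"
      by (rule has_derivative_compose[rotated])
    then have "((\<lambda>t. ?G (x + t *\<^sub>R ?d)) has_real_derivative gradient \<phi> ?z \<bullet> ?d) (at t)"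
      by (rule has_derivative_imp_has_field_derivative) (simp add: inner_commute)
    then have "(?p has_real_derivative
        gradient \<phi> ?z \<bullet> ?d - gradient \<phi> x \<bullet> ?d - l * t * (norm ?d)\<^sup>2) (at t)"
      by (auto intro!: derivative_eq_intros)
    moreover have "gradient \<phi> ?z \<bullet> ?d - gradient \<phi> x \<bullet> ?d \<le> l * t * (norm ?d)\<^sup>2"
    proof -
      have "gradient \<phi> ?z \<bullet> ?d - gradient \<phi> x \<bullet> ?d \<le> norm (gradient \<phi> ?z - gradient \<phi> x) * norm ?d"
        by (metis inner_diff_left norm_cauchy_schwarz)
      also have "norm (gradient \<phi> ?z - gradient \<phi> x) \<le> l * (t * norm ?d)"
        using assms(1) lipschitz_onD[of l U "gradient \<phi>" ?z x] z \<open>x \<in> U\<close> t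
        by (auto simp: lipschitz_gradient_on_def dist_norm)
      finally show ?thesis by (simp add: power2_eq_square mult_ac mult_right_mono)
    qed
    ultimately show "\<exists>m. (?p has_real_derivative m) (at t) \<and> m \<le> 0" by force
  qed simp
  then show ?thesis by simp
qed

section \<open>The proximal iteration and its cluster points\<close>

text \<open>
  Minimality of an extended-valued maximum, in real arithmetic: each branch \<open>j\<close> at the minimizer \<open>z\<close> lies
  below some branch \<open>i\<close> at the competitor \<open>y\<close>.  This form avoids limits of maxima.
\<close>

lemma argmin_max_model_real:
  fixes f :: "'m::finite \<Rightarrow> 'a::real_inner \<Rightarrow> ereal" and w :: "'m \<Rightarrow> 'a"
  assumes fin: "\<And>i y. y \<in> S \<Longrightarrow> \<bar>f i y\<bar> \<noteq> \<infinity>" and "x \<in> S" and "y \<in> S"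
    and opt: "is_arg_min (\<lambda>y. (MAX i\<in>UNIV. f i y - f i x + ereal (w i \<bullet> (y - x)))
                 + ereal (c * (norm (y - x))\<^sup>2)) (\<lambda>y. y \<in> S) z"
  shows "\<exists>i. real_of_ereal (f j z) - real_of_ereal (f j x) + w j \<bullet> (z - x) + c * (norm (z - x))\<^sup>2
      \<le> real_of_ereal (f i y) - real_of_ereal (f i x) + w i \<bullet> (y - x) + c * (norm (y - x))\<^sup>2"
proof -
  let ?r = "\<lambda>i y. real_of_ereal (f i y) - real_of_ereal (f i x) + w i \<bullet> (y - x)"
  let ?M = "\<lambda>y. MAX i\<in>UNIV. f i y - f i x + ereal (w i \<bullet> (y - x))"
  have real: "f i y - f i x + ereal (w i \<bullet> (y - x)) = ereal (?r i y)" if "y \<in> S" for i y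
    using fin[OF that, of i] fin[OF \<open>x \<in> S\<close>, of i] by (cases "f i y"; cases "f i x") auto
  have z: "z \<in> S" and le: "?M z + ereal (c * (norm (z - x))\<^sup>2) \<le> ?M y + ereal (c * (norm (y - x))\<^sup>2)"
    using opt \<open>y \<in> S\<close> unfolding is_arg_min_linorder by auto
  have "?M y \<in> range (\<lambda>i. f i y - f i x + ereal (w i \<bullet> (y - x)))"
    by (rule Max_in) auto
  then obtain i where "?M y = f i y - f i x + ereal (w i \<bullet> (y - x))" by blast
  then have i: "?M y = ereal (?r i y)" by (simp only: real[OF \<open>y \<in> S\<close>])
  have "ereal (?r j z) \<le> ?M z"
    unfolding real[OF z, symmetric] by (rule Max_ge) auto
  then have "ereal (?r j z) + ereal (c * (norm (z - x))\<^sup>2) \<le> ?M z + ereal (c * (norm (z - x))\<^sup>2)"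
    by (rule add_right_mono)
  also note le
  finally have "?r j z + c * (norm (z - x))\<^sup>2 \<le> ?r i y + c * (norm (y - x))\<^sup>2"
    unfolding i by simp
  then show ?thesis by blast
qed

lemma summable_of_sufficient_decrease:
  fixes \<Phi> d :: "nat \<Rightarrow> real"
  assumes "0 < \<kappa>" and "\<And>k. 0 \<le> d k" and dec: "\<And>k. \<Phi> (Suc k) + \<kappa> * d k \<le> \<Phi> k"
    and "\<And>k. c \<le> \<Phi> k"
  shows "summable d"
proof (rule summableI_nonneg_bounded)
  fix n
  have "\<kappa> * (\<Sum>k<n. d k) \<le> \<Phi> 0 - \<Phi> n"
  proof (induction n)
    case (Suc n)
    then show ?case using dec[of n] by (simp add: distrib_left)
  qed simp
  then have "\<kappa> * (\<Sum>k<n. d k) \<le> \<Phi> 0 - c" using assms(4)[of n] by simp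
  then show "(\<Sum>k<n. d k) \<le> (\<Phi> 0 - c) / \<kappa>" using \<open>0 < \<kappa>\<close> by (simp add: field_simps)
qed fact

text \<open>
  If every branch of the limit model were negative at \<open>y\<close>, then for large \<open>k\<close> every branch of the
  \<open>k\<close>-th model at \<open>y\<close> would lie below the value of a fixed branch \<open>j\<close> at \<open>Z k\<close>, which tends to zero.  The
  step-size terms need no limit: the one at \<open>Z k\<close> is nonnegative and the one at \<open>y\<close> is bounded
  through \<open>c\<close>.
\<close>

lemma limit_of_model_minimizers:
  fixes F :: "'m::finite \<Rightarrow> 'a::real_inner \<Rightarrow> real"
  assumes X: "X \<longlonglongrightarrow> a" and Z: "Z \<longlonglongrightarrow> a" and W: "\<And>i. (\<lambda>k. W k i) \<longlonglongrightarrow> w i"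
    and cont: "\<And>i. isCont (F i) a" and c: "\<forall>\<^sub>F k in sequentially. 0 \<le> cs k \<and> cs k \<le> c"
    and opt: "\<And>(k::nat) j. \<exists>i. F j (Z k) - F j (X k) + W k j \<bullet> (Z k - X k) + cs k * (norm (Z k - X k))\<^sup>2
        \<le> F i y - F i (X k) + W k i \<bullet> (y - X k) + cs k * (norm (y - X k))\<^sup>2"
  shows "\<exists>i. 0 \<le> F i y - F i a + w i \<bullet> (y - a) + c * (norm (y - a))\<^sup>2"
proof (rule ccontr)
  assume "\<not> ?thesis"
  then have neg: "F i y - F i a + w i \<bullet> (y - a) + c * (norm (y - a))\<^sup>2 < 0" for i
    by (simp add: not_le)
  fix j :: 'm
  let ?A = "\<lambda>k. F j (Z k) - F j (X k) + W k j \<bullet> (Z k - X k)"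
  let ?B = "\<lambda>i k. F i y - F i (X k) + W k i \<bullet> (y - X k) + c * (norm (y - X k))\<^sup>2"
  have "\<forall>\<^sub>F k in sequentially. ?B i k < ?A k" for i
  proof -
    have FX: "(\<lambda>k. F i (X k)) \<longlonglongrightarrow> F i a" and FZ: "(\<lambda>k. F i (Z k)) \<longlonglongrightarrow> F i a" for i
      using isCont_tendsto_compose[OF cont] X Z by auto
    have "(\<lambda>k. ?B i k - ?A k) \<longlonglongrightarrow>
        (F i y - F i a + w i \<bullet> (y - a) + c * (norm (y - a))\<^sup>2) - (F j a - F j a + w j \<bullet> (a - a))"
      by (intro tendsto_intros X Z W FX FZ)
    then have "\<forall>\<^sub>F k in sequentially. ?B i k - ?A k < 0"
      by (rule order_tendstoD) (use neg[of i] in simp)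
    then show ?thesis by eventually_elim simp
  qed
  then have "\<forall>\<^sub>F k in sequentially. \<forall>i. ?B i k < ?A k"
    by (rule eventually_all_finite)
  then have "\<forall>\<^sub>F k in sequentially. False"
    using c
  proof eventually_elim
    case (elim k)
    obtain i where "?A k + cs k * (norm (Z k - X k))\<^sup>2
        \<le> F i y - F i (X k) + W k i \<bullet> (y - X k) + cs k * (norm (y - X k))\<^sup>2"
      using opt by blast
    moreover have "0 \<le> cs k * (norm (Z k - X k))\<^sup>2" using elim by simp
    moreover have "cs k * (norm (y - X k))\<^sup>2 \<le> c * (norm (y - X k))\<^sup>2"
      using elim by (intro mult_right_mono) auto
    moreover have "?B i k < ?A k" using elim by blast
    ultimately show False by linarith
  qed
  then show False by simp
qed

lemma lipschitz_on_linear_plus_quadratic: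
  fixes a w :: "'a::real_inner"
  assumes "0 \<le> c" and "0 \<le> r"
  shows "(norm w + 2 * c * r)-lipschitz_on (cball a r) (\<lambda>y. w \<bullet> (y - a) + c * (norm (y - a))\<^sup>2)"
proof (rule lipschitz_onI)
  fix y z assume "y \<in> cball a r" "z \<in> cball a r"
  then have yz: "norm (y - a) \<le> r" "norm (z - a) \<le> r" by (auto simp: dist_norm norm_minus_commute)
  have "\<bar>w \<bullet> (y - a) - w \<bullet> (z - a)\<bar> \<le> norm w * norm (y - z)"
    using Cauchy_Schwarz_ineq2[of w "y - z"] by (simp add: inner_diff_right)
  moreover have "\<bar>(norm (y - a))\<^sup>2 - (norm (z - a))\<^sup>2\<bar> \<le> norm (y - z) * (2 * r)"
  proof -
    have "\<bar>(norm (y - a))\<^sup>2 - (norm (z - a))\<^sup>2\<bar>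
        = \<bar>norm (y - a) - norm (z - a)\<bar> * (norm (y - a) + norm (z - a))"
      by (simp add: power2_eq_square square_diff_square_factored abs_mult mult.commute)
    also have "\<dots> \<le> norm (y - z) * (2 * r)"
      using yz norm_triangle_ineq3[of "y - a" "z - a"] by (intro mult_mono) auto
    finally show ?thesis .
  qed
  then have "\<bar>c * (norm (y - a))\<^sup>2 - c * (norm (z - a))\<^sup>2\<bar> \<le> c * (norm (y - z) * (2 * r))"
    using \<open>0 \<le> c\<close> by (simp add: abs_mult mult_left_mono flip: right_diff_distrib)
  ultimately show "dist (w \<bullet> (y - a) + c * (norm (y - a))\<^sup>2) (w \<bullet> (z - a) + c * (norm (z - a))\<^sup>2)
      \<le> (norm w + 2 * c * r) * dist y z"
    by (simp add: dist_norm algebra_simps abs_le_iff)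
qed (use assms in simp)

lemma locally_lipschitz_uniform_cball:
  fixes f :: "'m::finite \<Rightarrow> 'a::euclidean_space \<Rightarrow> ereal"
  assumes "\<And>i. locally_lipschitz_on U (f i)" and "a \<in> U"
  shows "\<exists>r>0. \<exists>L. \<forall>i. L-lipschitz_on (cball a r) (\<lambda>y. real_of_ereal (f i y))
      \<and> (\<forall>y\<in>cball a r. \<bar>f i y\<bar> \<noteq> \<infinity>)"
proof -
  have "\<forall>i. \<exists>V L. open V \<and> a \<in> V \<and> (\<forall>y\<in>V. \<bar>f i y\<bar> \<noteq> \<infinity>)
      \<and> L-lipschitz_on V (\<lambda>y. real_of_ereal (f i y))"
    using assms unfolding locally_lipschitz_on_def by blast
  then obtain V L where VL: "\<forall>i. open (V i) \<and> a \<in> V i \<and> (\<forall>y\<in>V i. \<bar>f i y\<bar> \<noteq> \<infinity>)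
      \<and> (L i)-lipschitz_on (V i) (\<lambda>y. real_of_ereal (f i y))"
    unfolding choice_iff by (elim exE)
  have "open (\<Inter>i. V i)" "a \<in> (\<Inter>i. V i)" using VL by (auto intro: open_INT)
  then obtain r where "0 < r" and r: "cball a r \<subseteq> (\<Inter>i. V i)"
    unfolding open_contains_cball by blast
  have lip: "(L i)-lipschitz_on (V i) (\<lambda>y. real_of_ereal (f i y))"
    and fin: "\<forall>y\<in>V i. \<bar>f i y\<bar> \<noteq> \<infinity>" and sub: "cball a r \<subseteq> V i" for i
    using spec[OF VL, of i] r by auto
  have "L i \<le> sum L UNIV" for i
    using lipschitz_on_nonneg[OF lip] by (intro member_le_sum) auto
  then have "(sum L UNIV)-lipschitz_on (cball a r) (\<lambda>y. real_of_ereal (f i y))" for i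
    by (rule lipschitz_on_mono[OF lip sub])
  moreover have "\<forall>y\<in>cball a r. \<bar>f i y\<bar> \<noteq> \<infinity>" for i
    using fin[of i] sub[of i] by (meson subsetD)
  ultimately show ?thesis using \<open>0 < r\<close> by (intro exI[of _ r] conjI exI[of _ "sum L UNIV"] allI)
qed

text \<open>
  The multiplier rule for the functions \<open>f i\<close> plus a linear and a quadratic term, normalized to vanish
  at \<open>a\<close>.  The smooth terms are then subtracted from the regular subgradients; their gradients
  \<open>w i + (2 * c) *\<^sub>R (z - a)\<close> tend to \<open>w i\<close>.
\<close>

lemma minimax_stationarity:
  fixes S :: "'a::euclidean_space set" and f :: "'m::finite \<Rightarrow> 'a \<Rightarrow> ereal" and w :: "'m \<Rightarrow> 'a"
  assumes "closed S" and "a \<in> S" and "a \<in> U" and "0 \<le> c"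
    and ninf: "\<And>i y. f i y \<noteq> -\<infinity>" and lip: "\<And>i. locally_lipschitz_on U (f i)"
    and min: "\<And>y. y \<in> S \<Longrightarrow> \<exists>i. 0 \<le> real_of_ereal (f i y) - real_of_ereal (f i a)
                + w i \<bullet> (y - a) + c * (norm (y - a))\<^sup>2"
  shows "\<exists>(lam::real^'m) v. (\<forall>i. 0 \<le> lam $ i) \<and> (\<Sum>i\<in>UNIV. lam $ i) = 1
      \<and> (\<forall>i. v i \<in> limiting_subdifferential (f i) a)
      \<and> - (\<Sum>i\<in>UNIV. lam $ i *\<^sub>R (v i + w i)) \<in> limiting_normal_cone S a"
proof -
  obtain r L where "0 < r"
    and "\<forall>i. L-lipschitz_on (cball a r) (\<lambda>y. real_of_ereal (f i y))
      \<and> (\<forall>y\<in>cball a r. \<bar>f i y\<bar> \<noteq> \<infinity>)"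
    using locally_lipschitz_uniform_cball[of U f, OF lip \<open>a \<in> U\<close>] by blast
  then have L: "\<And>i. L-lipschitz_on (cball a r) (\<lambda>y. real_of_ereal (f i y))"
    and fin: "\<And>i y. y \<in> cball a r \<Longrightarrow> \<bar>f i y\<bar> \<noteq> \<infinity>"
    by (fast, simp)
  let ?F = "\<lambda>i y. real_of_ereal (f i y)"
  let ?q = "\<lambda>i y. w i \<bullet> (y - a) + c * (norm (y - a))\<^sup>2"
  define \<phi> where "\<phi> i y = ?F i y + (?q i y - ?F i a)" for i y
  define K where "K = L + ((\<Sum>i\<in>UNIV. norm (w i)) + 2 * c * r)"
  have "K-lipschitz_on (cball a r) (\<phi> i)" for i
  proof -
    have "norm (w i) \<le> (\<Sum>i\<in>UNIV. norm (w i))" by (rule member_le_sum) auto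
    then have "((\<Sum>i\<in>UNIV. norm (w i)) + 2 * c * r)-lipschitz_on (cball a r) (?q i)"
      by (intro lipschitz_on_mono[OF lipschitz_on_linear_plus_quadratic[where c = c and r = r]])
         (use \<open>0 \<le> c\<close> \<open>0 < r\<close> in auto)
    from lipschitz_on_add[OF L[of i] lipschitz_on_diff[OF this lipschitz_on_constant[of _ "?F i a"]]]
    show ?thesis by (simp only: \<phi>_def[abs_def] K_def add_0_right)
  qed
  moreover have "\<phi> i a = 0" for i by (simp add: \<phi>_def)
  moreover have "\<exists>i. 0 \<le> \<phi> i y" if "y \<in> S" for y
    using min[OF that] by (simp add: \<phi>_def algebra_simps)
  ultimately have "\<exists>(lam :: real^'m) (v :: 'a^'m) (Z :: nat \<Rightarrow> 'a^'m) V.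
      (\<forall>i. 0 \<le> lam $ i) \<and> (\<Sum>i\<in>UNIV. lam $ i) = 1
      \<and> (\<forall>k i. Z k $ i \<in> ball a r \<and> regular_subgradient (\<phi> i) (Z k $ i) (V k $ i))
      \<and> (\<forall>i. (\<lambda>k. Z k $ i) \<longlonglongrightarrow> a \<and> (\<lambda>k. V k $ i) \<longlonglongrightarrow> v $ i)
      \<and> - (\<Sum>i\<in>UNIV. lam $ i *\<^sub>R v $ i) \<in> limiting_normal_cone S a"
    using \<open>closed S\<close> \<open>a \<in> S\<close> \<open>0 < r\<close> by (intro limiting_multiplier_rule[of S a r K \<phi>])
  then obtain lam :: "real^'m" and v and Z V :: "nat \<Rightarrow> 'a^'m" where
    "(\<forall>i. 0 \<le> lam $ i) \<and> (\<Sum>i\<in>UNIV. lam $ i) = 1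
      \<and> (\<forall>k i. Z k $ i \<in> ball a r \<and> regular_subgradient (\<phi> i) (Z k $ i) (V k $ i))
      \<and> (\<forall>i. (\<lambda>k. Z k $ i) \<longlonglongrightarrow> a \<and> (\<lambda>k. V k $ i) \<longlonglongrightarrow> v $ i)
      \<and> - (\<Sum>i\<in>UNIV. lam $ i *\<^sub>R v $ i) \<in> limiting_normal_cone S a"
    by (elim exE)
  then have lam: "\<And>i. 0 \<le> lam $ i" "(\<Sum>i\<in>UNIV. lam $ i) = 1"
    and Z: "\<And>k i. Z k $ i \<in> ball a r" "\<And>i. (\<lambda>k. Z k $ i) \<longlonglongrightarrow> a"
    and sub: "\<And>k i. regular_subgradient (\<phi> i) (Z k $ i) (V k $ i)"
    and V: "\<And>i. (\<lambda>k. V k $ i) \<longlonglongrightarrow> v $ i"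
    and normal: "- (\<Sum>i\<in>UNIV. lam $ i *\<^sub>R v $ i) \<in> limiting_normal_cone S a"
    by blast+
  have "v $ i - w i \<in> limiting_subdifferential (f i) a" for i
  proof (rule limiting_subdifferentialI[OF ninf fin fin])
    show "a \<in> cball a r" "Z k $ i \<in> cball a r" for k using \<open>0 < r\<close> Z(1)[of k i] by auto
    show "(\<lambda>k. Z k $ i) \<longlonglongrightarrow> a" by (rule Z)
    have lin: "GDERIV (\<lambda>y. w i \<bullet> (y - a)) z :> w i" for z
      by (auto simp: gderiv_def inner_commute intro!: derivative_eq_intros)
    have smooth: "GDERIV (\<lambda>y. ?q i y - ?F i a) z :> w i + (2 * c) *\<^sub>R (z - a)" for z
      using GDERIV_diff[OF GDERIV_add[OF lin GDERIV_half_sq_dist] GDERIV_const] by simp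
    show "regular_subgradient (?F i) (Z k $ i) (V k $ i - (w i + (2 * c) *\<^sub>R (Z k $ i - a)))" for k
      by (rule regular_subgradient_diff_smooth[OF sub[of i k, unfolded \<phi>_def[abs_def]] smooth])
    have "(\<lambda>k. V k $ i - (w i + (2 * c) *\<^sub>R (Z k $ i - a))) \<longlonglongrightarrow> v $ i - (w i + (2 * c) *\<^sub>R (a - a))"
      by (intro tendsto_intros V Z)
    then show "(\<lambda>k. V k $ i - (w i + (2 * c) *\<^sub>R (Z k $ i - a))) \<longlonglongrightarrow> v $ i - w i"
      by (simp only: diff_self scaleR_zero_right add_0_right)
    show "isCont (?F i) a"
      by (rule continuous_on_interior[OF lipschitz_on_continuous_on[OF L[of i]]])
         (use \<open>0 < r\<close> in \<open>simp add: interior_cball\<close>)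
  qed
  moreover have "- (\<Sum>i\<in>UNIV. lam $ i *\<^sub>R ((v $ i - w i) + w i)) \<in> limiting_normal_cone S a"
    using normal by simp
  ultimately show ?thesis
    by (intro exI[of _ lam] exI[of _ "\<lambda>i. v $ i - w i"] conjI allI lam)
qed

theorem theorem4p2:
  fixes S U :: "(real^'n) set"
    and f g :: "'m::finite \<Rightarrow> real^'n \<Rightarrow> ereal"
    and h :: "'m \<Rightarrow> real^'n \<Rightarrow> real"
    and l \<beta> \<gamma>bar :: real
    and x :: "nat \<Rightarrow> real^'n"
    and u :: "nat \<Rightarrow> 'm \<Rightarrow> real^'n"
    and \<gamma> :: "nat \<Rightarrow> real"
  assumes "S \<noteq> {}" and "closed S"
    and "0 \<le> l" and "0 \<le> \<beta>"
    and "open U" and "S \<subseteq> U"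
    and "\<And>i y. f i y \<noteq> - \<infinity>" and "\<And>i. locally_lipschitz_on U (f i)"
    and "\<And>i y. g i y \<noteq> - \<infinity>" and "\<And>i. lipschitz_gradient_on l U (g i)"
    and "\<And>i. weakly_convex_on \<beta> U (\<lambda>y. ereal (h i y))"
    and "0 < \<gamma>bar" and "l + \<beta> = 0 \<or> \<gamma>bar < 1 / (l + \<beta>)"
    and "x 0 \<in> S"
    and "\<And>k i. u k i \<in> limiting_subdifferential (\<lambda>y. ereal (h i y)) (x k)"
    and "\<And>k. 0 < \<gamma> k \<and> \<gamma> k \<le> \<gamma>bar"
    and "\<And>k. is_arg_min
           (\<lambda>y. (MAX i\<in>UNIV. f i y - f i (x k)
                   + ereal ((gradient (g i) (x k) - u k i) \<bullet> (y - x k)))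
                 + ereal (1 / (2 * \<gamma> k) * (norm (y - x k))\<^sup>2))
           (\<lambda>y. y \<in> S) (x (Suc k))"
  shows "(\<forall>i k. objective f g h i (x (Suc k))
              + ereal ((1 / (2 * \<gamma> k) - (l + \<beta>) / 2) * (norm (x (Suc k) - x k))\<^sup>2)
            \<le> objective f g h i (x k))
    \<and> ((\<exists>i. \<exists>c::real. \<forall>y\<in>S. ereal c \<le> objective f g h i y) \<longrightarrow>
          summable (\<lambda>k. (norm (x (Suc k) - x k))\<^sup>2) \<and> (\<lambda>k. x (Suc k) - x k) \<longlonglongrightarrow> 0)
    \<and> ((\<exists>i. bounded {y \<in> S. objective f g h i y \<le> objective f g h i (x 0)}) \<longrightarrow>
          bounded (range x))
    \<and> (liminf (\<lambda>k. ereal (\<gamma> k)) > 0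
         \<and> (\<exists>i. \<exists>c::real. \<forall>y\<in>S. ereal c \<le> objective f g h i y) \<longrightarrow>
          (\<forall>xbar. (\<exists>r::nat \<Rightarrow> nat. strict_mono r \<and> (x \<circ> r) \<longlonglongrightarrow> xbar) \<longrightarrow>
             stationary_point S f g h xbar))"
proof -
  note f_lip = assms(8) and g_smooth = assms(10) and u_sub = assms(15) and x_opt = assms(17)
  let ?F = "\<lambda>i y. real_of_ereal (f i y)" and ?G = "\<lambda>i y. real_of_ereal (g i y)"
  let ?D = "\<lambda>k. (norm (x (Suc k) - x k))\<^sup>2"
  let ?w = "\<lambda>k i. gradient (g i) (x k) - u k i"
  define \<Phi> where "\<Phi> i y = ?F i y + ?G i y - h i y" for i y
  have fin_f: "\<bar>f i y\<bar> \<noteq> \<infinity>" if "y \<in> U" for i y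
    using f_lip[of i] that unfolding locally_lipschitz_on_def by metis
  have fin_g: "\<bar>g i y\<bar> \<noteq> \<infinity>" if "y \<in> U" for i y
    using g_smooth[of i] that by (simp add: lipschitz_gradient_on_def)
  have SU: "y \<in> U" if "y \<in> S" for y using \<open>S \<subseteq> U\<close> that by blast
  have conv: "convex_on U (\<lambda>y. h i y + \<beta> / 2 * (norm y)\<^sup>2)" for i
    using assms(11)[of i] by (simp add: weakly_convex_on_real_iff)
  then have "convex U" by (rule convex_on_imp_convex)
  have xS: "x k \<in> S" for k
  proof (cases k)
    case (Suc n)
    then show ?thesis using x_opt[of n] by (simp add: is_arg_min_def)
  qed (simp add: assms)
  have xU: "x k \<in> U" for k using xS SU by blast
  have model: "\<exists>i. ?F j (x (Suc k)) - ?F j (x k) + ?w k j \<bullet> (x (Suc k) - x k) + 1 / (2 * \<gamma> k) * ?D k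
      \<le> ?F i y - ?F i (x k) + ?w k i \<bullet> (y - x k) + 1 / (2 * \<gamma> k) * (norm (y - x k))\<^sup>2"
    if "y \<in> S" for j k y
    by (rule argmin_max_model_real[OF fin_f[OF SU] xS that x_opt])
  have obj: "objective f g h i y = ereal (\<Phi> i y)" if "y \<in> S" for i y
    using fin_f[OF SU[OF that], of i] fin_g[OF SU[OF that], of i]
    by (cases "f i y"; cases "g i y") (auto simp: objective_def \<Phi>_def)
  have h_ineq: "h i (x k) + u k i \<bullet> (y - x k) - \<beta> / 2 * (norm (y - x k))\<^sup>2 \<le> h i y" if "y \<in> U" for i k y
    by (rule weakly_convex_subgradient_inequality[OF conv \<open>0 \<le> \<beta>\<close> \<open>open U\<close> xU that u_sub])
  have dec: "\<Phi> i (x (Suc k)) + (1 / (2 * \<gamma> k) - (l + \<beta>) / 2) * ?D k \<le> \<Phi> i (x k)" for i k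
  proof -
    \<comment> \<open>the competitor \<open>x k\<close> itself gives the model value zero\<close>
    have "?F i (x (Suc k)) - ?F i (x k) + ?w k i \<bullet> (x (Suc k) - x k) + 1 / (2 * \<gamma> k) * ?D k \<le> 0"
      using model[OF xS[of k], of i k] by simp
    moreover have "?G i (x (Suc k)) \<le> ?G i (x k) + gradient (g i) (x k) \<bullet> (x (Suc k) - x k) + l / 2 * ?D k"
      by (rule descent_lemma[OF g_smooth \<open>convex U\<close> xU xU])
    moreover note h_ineq[OF xU[of "Suc k"], of i k]
    moreover have "(1 / (2 * \<gamma> k) - (l + \<beta>) / 2) * ?D k
        = 1 / (2 * \<gamma> k) * ?D k - l / 2 * ?D k - \<beta> / 2 * ?D k"
      by (simp add: algebra_simps add_divide_distrib)
    moreover have "?w k i \<bullet> (x (Suc k) - x k)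
        = gradient (g i) (x k) \<bullet> (x (Suc k) - x k) - u k i \<bullet> (x (Suc k) - x k)"
      by (rule inner_diff_left)
    ultimately show ?thesis unfolding \<Phi>_def by linarith
  qed
  define \<kappa> where "\<kappa> = 1 / (2 * \<gamma>bar) - (l + \<beta>) / 2"
  have "(l + \<beta>) * \<gamma>bar < 1"
    using assms(3,4,12,13) by (cases "l + \<beta> = 0") (auto simp: field_simps)
  then have "0 < \<kappa>" using \<open>0 < \<gamma>bar\<close> by (simp add: \<kappa>_def field_simps)
  have \<kappa>_le: "\<kappa> \<le> 1 / (2 * \<gamma> k) - (l + \<beta>) / 2" for k
    using assms(16)[of k] by (simp add: \<kappa>_def frac_le)
  have dec_\<kappa>: "\<Phi> i (x (Suc k)) + \<kappa> * ?D k \<le> \<Phi> i (x k)" for i k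
    using dec[of i k] mult_right_mono[OF \<kappa>_le[of k], of "?D k"] by simp
  have descent: "\<forall>i k. objective f g h i (x (Suc k))
      + ereal ((1 / (2 * \<gamma> k) - (l + \<beta>) / 2) * (norm (x (Suc k) - x k))\<^sup>2) \<le> objective f g h i (x k)"
    using dec by (simp add: obj[OF xS])
  have square_summable: "summable ?D \<and> (\<lambda>k. x (Suc k) - x k) \<longlonglongrightarrow> 0"
    if bound: "\<exists>i. \<exists>c::real. \<forall>y\<in>S. ereal c \<le> objective f g h i y"
  proof -
    obtain i c where "\<forall>y\<in>S. ereal c \<le> objective f g h i y" using bound by blast
    then have "c \<le> \<Phi> i (x k)" for k using obj[OF xS, of i k] xS[of k] by force
    then have sum: "summable ?D"
      using \<open>0 < \<kappa>\<close> dec_\<kappa>[of i]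
      by (intro summable_of_sufficient_decrease[where \<kappa> = \<kappa> and \<Phi> = "\<lambda>k. \<Phi> i (x k)" and c = c]) auto
    have "(\<lambda>k. sqrt (?D k)) \<longlonglongrightarrow> sqrt 0"
      by (intro tendsto_real_sqrt summable_LIMSEQ_zero sum)
    then have "(\<lambda>k. norm (x (Suc k) - x k)) \<longlonglongrightarrow> 0" by simp
    with sum show ?thesis by (simp only: tendsto_norm_zero_iff simp_thms)
  qed
  have bounded_iterates: "bounded (range x)"
    if level: "\<exists>i. bounded {y \<in> S. objective f g h i y \<le> objective f g h i (x 0)}"
  proof -
    obtain i where i: "bounded {y \<in> S. objective f g h i y \<le> objective f g h i (x 0)}"
      using level by blast
    have "\<Phi> i (x k) \<le> \<Phi> i (x 0)" for k
    proof (induction k)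
      case (Suc k)
      have "0 \<le> \<kappa> * ?D k" using \<open>0 < \<kappa>\<close> by simp
      with Suc dec_\<kappa>[of i k] show ?case by linarith
    qed simp
    then have "range x \<subseteq> {y \<in> S. objective f g h i y \<le> objective f g h i (x 0)}"
      using xS by (auto simp: obj)
    with i show ?thesis by (rule bounded_subset)
  qed
  have cluster_stationary: "stationary_point S f g h a"
    if liminf: "liminf (\<lambda>k. ereal (\<gamma> k)) > 0"
      and bound: "\<exists>i. \<exists>c::real. \<forall>y\<in>S. ereal c \<le> objective f g h i y"
      and r: "strict_mono r" and lim: "(x \<circ> r) \<longlonglongrightarrow> a" for a and r :: "nat \<Rightarrow> nat"
  proof -
    have "a \<in> S" using closed_sequentially[OF \<open>closed S\<close> _ lim] xS by simp
    then have "a \<in> U" by (rule SU)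
    obtain \<gamma>0 where "0 < ereal \<gamma>0" and "ereal \<gamma>0 < liminf (\<lambda>k. ereal (\<gamma> k))"
      using ereal_dense2[OF liminf] by blast
    then have "\<forall>\<^sub>F k in sequentially. \<gamma>0 < \<gamma> k" and "0 < \<gamma>0"
      using less_LiminfD by fastforce+
    have cont_h: "continuous_on U (h i)" for i
      by (rule weakly_convex_continuous_on[OF \<open>open U\<close> conv])
    \<comment> \<open>collecting the subgradients in one vector gives a single subsequence that serves all \<open>i\<close>\<close>
    define u' :: "nat \<Rightarrow> (real^'n)^'m" where "u' k = (\<chi> i. u (r k) i)" for k
    have "bounded (range (\<lambda>k. u (r k) i))" for i
      by (rule weakly_convex_subgradients_bounded[OF \<open>open U\<close> \<open>a \<in> U\<close> cont_h lim])
         (use h_ineq in simp)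
    then have "\<forall>i. \<exists>B. \<forall>k. norm (u (r k) i) \<le> B" by (simp add: bounded_iff)
    then obtain B where B: "\<forall>i k. norm (u (r k) i) \<le> B i" unfolding choice_iff by blast
    have "norm (u' k) \<le> (\<Sum>i\<in>UNIV. B i)" for k
    proof -
      have "norm (u' k) \<le> (\<Sum>i\<in>UNIV. norm (u' k $ i))"
        by (subst norm_vec_def) (rule L2_set_le_sum, simp)
      also have "\<dots> \<le> (\<Sum>i\<in>UNIV. B i)"
        using B by (intro sum_mono) (simp add: u'_def)
      finally show ?thesis .
    qed
    then have "bounded (range u')" by (auto simp: bounded_iff)
    then obtain c \<rho> where \<rho>: "strict_mono \<rho>" and c: "(u' \<circ> \<rho>) \<longlonglongrightarrow> c"
      using bounded_imp_convergent_subsequence by blast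
    define \<sigma> where "\<sigma> = r \<circ> \<rho>"
    have \<sigma>: "strict_mono \<sigma>" unfolding \<sigma>_def using r \<rho> by (rule strict_mono_o)
    have X: "(\<lambda>k. x (\<sigma> k)) \<longlonglongrightarrow> a"
      using LIMSEQ_subseq_LIMSEQ[OF lim \<rho>] by (simp add: \<sigma>_def o_def)
    have u_lim: "(\<lambda>k. u (\<sigma> k) i) \<longlonglongrightarrow> c $ i" for i
      using tendsto_vec_nth[OF c, of i] by (simp add: u'_def \<sigma>_def o_def)
    have "(\<lambda>k. x (\<sigma> k) + (x (Suc (\<sigma> k)) - x (\<sigma> k))) \<longlonglongrightarrow> a + 0"
      using LIMSEQ_subseq_LIMSEQ[OF conjunct2[OF square_summable[OF bound]] \<sigma>]
      by (intro tendsto_add X) (simp add: o_def)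
    then have Z: "(\<lambda>k. x (Suc (\<sigma> k))) \<longlonglongrightarrow> a" by simp
    have c_sub: "c $ i \<in> limiting_subdifferential (\<lambda>y. ereal (h i y)) a" for i
    proof (rule limiting_subdifferentialI)
      have "h i a + c $ i \<bullet> (y - a) - \<beta> / 2 * (norm (y - a))\<^sup>2 \<le> h i y" if "y \<in> U" for y
      proof (rule LIMSEQ_le_const2)
        have "isCont (h i) a" using cont_h \<open>open U\<close> \<open>a \<in> U\<close> by (simp add: continuous_on_eq_continuous_at)
        then show "(\<lambda>k. h i (x (\<sigma> k)) + u (\<sigma> k) i \<bullet> (y - x (\<sigma> k)) - \<beta> / 2 * (norm (y - x (\<sigma> k)))\<^sup>2)
            \<longlonglongrightarrow> h i a + c $ i \<bullet> (y - a) - \<beta> / 2 * (norm (y - a))\<^sup>2"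
          by (intro tendsto_intros X u_lim isCont_tendsto_compose[of a "h i"])
      qed (use h_ineq[OF that] in blast)
      then show "regular_subgradient (\<lambda>y. real_of_ereal (ereal (h i y))) a (c $ i)"
        using regular_subgradient_of_quadratic_minorant[OF \<open>open U\<close> \<open>a \<in> U\<close>, of "h i" "c $ i" \<beta>] by simp
      show "isCont (\<lambda>y. real_of_ereal (ereal (h i y))) a"
        using cont_h \<open>open U\<close> \<open>a \<in> U\<close> by (simp add: continuous_on_eq_continuous_at)
    qed auto
    have cont_grad: "isCont (gradient (g i)) a" for i
    proof -
      have "l-lipschitz_on U (gradient (g i))"
        using g_smooth[of i] by (simp add: lipschitz_gradient_on_def)
      then have "continuous_on U (gradient (g i))" by (rule lipschitz_on_continuous_on)
      then show ?thesis using \<open>open U\<close> \<open>a \<in> U\<close> by (simp add: continuous_on_eq_continuous_at)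
    qed
    have W: "(\<lambda>k. ?w (\<sigma> k) i) \<longlonglongrightarrow> gradient (g i) a - c $ i" for i
      by (intro tendsto_diff u_lim isCont_tendsto_compose[OF cont_grad X])
    have cont_f: "isCont (?F i) a" for i
    proof -
      obtain V L where "open V" "a \<in> V" "L-lipschitz_on V (?F i)"
        using f_lip[of i] \<open>a \<in> U\<close> unfolding locally_lipschitz_on_def by blast
      then show ?thesis
        using lipschitz_on_continuous_on continuous_on_eq_continuous_at by blast
    qed
    \<comment> \<open>the proximal coefficients stay bounded because the step sizes stay away from zero\<close>
    have "\<forall>\<^sub>F k in sequentially. \<gamma>0 < \<gamma> (\<sigma> k)"
      using \<open>\<forall>\<^sub>F k in sequentially. \<gamma>0 < \<gamma> k\<close> \<sigma> by (rule eventually_subseq[rotated])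
    then have step: "\<forall>\<^sub>F k in sequentially. 0 \<le> 1 / (2 * \<gamma> (\<sigma> k)) \<and> 1 / (2 * \<gamma> (\<sigma> k)) \<le> 1 / (2 * \<gamma>0)"
      by eventually_elim (use \<open>0 < \<gamma>0\<close> in \<open>simp add: frac_le\<close>)
    have min: "\<exists>i. 0 \<le> ?F i y - ?F i a + (gradient (g i) a - c $ i) \<bullet> (y - a)
        + 1 / (2 * \<gamma>0) * (norm (y - a))\<^sup>2" if "y \<in> S" for y
      by (rule limit_of_model_minimizers[OF X Z W cont_f step model[OF that]])
    have "\<exists>(lam::real^'m) v. (\<forall>i. 0 \<le> lam $ i) \<and> (\<Sum>i\<in>UNIV. lam $ i) = 1
        \<and> (\<forall>i. v i \<in> limiting_subdifferential (f i) a)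
        \<and> - (\<Sum>i\<in>UNIV. lam $ i *\<^sub>R (v i + (gradient (g i) a - c $ i))) \<in> limiting_normal_cone S a"
      by (rule minimax_stationarity[OF \<open>closed S\<close> \<open>a \<in> S\<close> \<open>a \<in> U\<close> _ assms(7) f_lip min])
         (use \<open>0 < \<gamma>0\<close> in simp)
    then obtain lam :: "real^'m" and v where lam: "\<forall>i. 0 \<le> lam $ i" "(\<Sum>i\<in>UNIV. lam $ i) = 1"
      and v: "\<forall>i. v i \<in> limiting_subdifferential (f i) a"
      and normal: "- (\<Sum>i\<in>UNIV. lam $ i *\<^sub>R (v i + (gradient (g i) a - c $ i))) \<in> limiting_normal_cone S a"
      by blast
    let ?s = "\<lambda>i. lam $ i *\<^sub>R (v i + (gradient (g i) a - c $ i))"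
    let ?P = "\<lambda>i. (\<lambda>w. lam $ i *\<^sub>R w) ` {b + gradient (g i) a - e | b e.
        b \<in> limiting_subdifferential (f i) a \<and> e \<in> limiting_subdifferential (\<lambda>y. ereal (h i y)) a}"
    have "?s i \<in> ?P i" for i
    proof (rule imageI)
      have "v i + (gradient (g i) a - c $ i) = v i + gradient (g i) a - c $ i" by simp
      then show "v i + (gradient (g i) a - c $ i) \<in> {b + gradient (g i) a - e | b e.
          b \<in> limiting_subdifferential (f i) a \<and> e \<in> limiting_subdifferential (\<lambda>y. ereal (h i y)) a}"
        using v c_sub by blast
    qed
    then have "sum ?s UNIV \<in> (\<Sum>i\<in>UNIV. ?P i)"
      unfolding set_sum_alt[OF finite] by blast
    from set_plus_intro[OF this normal]
    have "0 \<in> (\<Sum>i\<in>UNIV. ?P i) + limiting_normal_cone S a" by simp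
    moreover have "lam \<noteq> 0" using lam(2) by auto
    ultimately show ?thesis
      unfolding stationary_point_def using \<open>a \<in> S\<close> lam(1) by blast
  qed
  from descent square_summable bounded_iterates cluster_stationary show ?thesis by blast
qed

end
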